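(* Let $m\geq1$ and let $(P,\Phi)$ be a logarithmic $SO(2m,\mathbb C)$-Higgs bundle on $(C,D)$ with nilpotent residues. Then $$\operatorname{Pf}(\Phi)\in H^0\bigl(C,K_C^m((m-1)D)\bigr).$$ If, for every $p_i\in D$, $$\operatorname{rk}\operatorname{Res}_{p_i}(\Phi)\leq 2m-4,$$ then $$\operatorname{Pf}(\Phi)\in H^0\bigl(C,K_C^m((m-2)D)\bigr).$$
   Context: $C$ is a compact Riemann surface of genus at least $2$ with canonical bundle $K_C$, and $D=p_1+\cdots+p_r$ is a reduced divisor on $C$. For $G=SO(2m,\mathbb C)$ with Lie algebra $\mathfrak g=\mathfrak{so}(2m,\mathbb C)$, a logarithmic $G$-Higgs bundle on $(C,D)$ is a pair $(P,\Phi)$ where $P$ is a holomorphic principal $G$-bundle on $C$ and $\Phi\in H^0(C,\operatorname{ad}(P)\otimes K_C(D))$, with $\operatorname{ad}(P)=P\times^G\mathfrak g$. In a coordinate $z$ centred at $p_i$ and a local trivialization, $\Phi=\left(\frac{N_i}{z}+A_i(z)\right)dz$ with $A_i$ holomorphic, and $N_i=\operatorname{Res}_{p_i}(\Phi)\in\mathfrak g$. An element $N$ of the reductive Lie algebra $\mathfrak g=\mathfrak z(\mathfrak g)\oplus[\mathfrak g,\mathfrak g]$ is called nilpotent if its component in $\mathfrak z(\mathfrak g)$ is zero and its component in $[\mathfrak g,\mathfrak g]$ is nilpotent; $\Phi$ has nilpotent residues if every $N_i$ is nilpotent. The rank $\operatorname{rk}$ is the rank in the standard $2m$-dimensional representation.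 $\operatorname{Pf}:\mathfrak{so}(2m,\mathbb C)\to\mathbb C$ is the Pfaffian, the invariant polynomial of degree $m$ on skew-symmetric $2m\times 2m$ matrices; $\operatorname{Pf}(\Phi)$ is the meromorphic $m$-differential given locally by $\operatorname{Pf}(s(z))\,dz^m$ when $\Phi=s(z)\,dz$ in a local oriented orthogonal trivialization. *)

theory Defs
  imports
    "HOL-Complex_Analysis.Complex_Analysis"
    "HOL-Homology.Homology"
    "HOL-Algebra.Free_Abelian_Groups"
    "HOL-Combinatorics.Permutations"
    "Jordan_Normal_Form.DL_Rank"
begin

hide_const (open) Determinants.det Finite_Cartesian_Product.mat Finite_Cartesian_Product.transpose
  Finite_Cartesian_Product.vec

section \<open>Compact Riemann surfaces\<close>

type_synonym 'a chart = "'a set \<times> ('a \<Rightarrow> complex)"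

definition chart_inv :: "'a chart \<Rightarrow> complex \<Rightarrow> 'a" where
  "chart_inv c = inv_into (fst c) (snd c)"

definition complex_chart :: "'a topology \<Rightarrow> 'a chart \<Rightarrow> bool" where
  "complex_chart X c \<longleftrightarrow>
     openin X (fst c) \<and> open (snd c ` fst c) \<and>
     homeomorphic_map (subtopology X (fst c)) (top_of_set (snd c ` fst c)) (snd c)"

record 'a surface =
  surface_top :: "'a topology"
  surface_atlas :: "'a chart set"

text \<open>The complex structure is the one generated by the given holomorphic atlas, which need
  not be maximal. Second countability follows from compactness.\<close>

definition compact_riemann_surface :: "'a surface \<Rightarrow> bool" where
  "compact_riemann_surface C \<longleftrightarrow>
     topspace (surface_top C) \<noteq> {} \<and>
     compact_space (surface_top C) \<and>
     connected_space (surface_top C) \<and>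
     Hausdorff_space (surface_top C) \<and>
     (\<forall>c\<in>surface_atlas C. complex_chart (surface_top C) c) \<and>
     (\<Union>c\<in>surface_atlas C. fst c) = topspace (surface_top C) \<and>
     (\<forall>c\<in>surface_atlas C. \<forall>d\<in>surface_atlas C.
        (snd d \<circ> chart_inv c) holomorphic_on (snd c ` (fst c \<inter> fst d)))"

text \<open>Genus \<open>g\<close> means that the first integral homology group is free of rank \<open>2 g\<close>.\<close>

definition has_genus :: "'a surface \<Rightarrow> nat \<Rightarrow> bool" where
  "has_genus C g \<longleftrightarrow> homology_group 1 (surface_top C) \<cong> free_Abelian_group {..<2 * g}"

definition holomorphic_on_surface :: "'a surface \<Rightarrow> 'a set \<Rightarrow> ('a \<Rightarrow> complex) \<Rightarrow> bool" where
  "holomorphic_on_surface C W f \<longleftrightarrow>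
     (\<forall>c\<in>surface_atlas C. (f \<circ> chart_inv c) holomorphic_on (snd c ` (fst c \<inter> W)))"

text \<open>The derivative \<open>dw/dz\<close> at \<open>x\<close>, where \<open>z\<close> is the coordinate of \<open>c\<close> and \<open>w\<close> that of \<open>d\<close>.\<close>

definition coord_deriv :: "'a chart \<Rightarrow> 'a chart \<Rightarrow> 'a \<Rightarrow> complex" where
  "coord_deriv d c x = deriv (snd d \<circ> chart_inv c) (snd c x)"

section \<open>Sections of powers of the canonical bundle with bounded poles\<close>

text \<open>For negative \<open>n\<close> this says that \<open>f\<close> has a zero of order at least \<open>-n\<close> at \<open>a\<close>.
  The value of \<open>f\<close> at \<open>a\<close> itself is irrelevant.\<close>

definition pole_order_le :: "int \<Rightarrow> (complex \<Rightarrow> complex) \<Rightarrow> complex \<Rightarrow> bool" where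
  "pole_order_le n f a \<longleftrightarrow>
     (\<exists>r>0. \<exists>h. h holomorphic_on ball a r \<and>
        (\<forall>w\<in>ball a r - {a}. f w = (w - a) powi (- n) * h w))"

text \<open>The space $H^0(C, K_C^m(nD))$ for a finite set \<open>D\<close> of points, regarded as a reduced
  divisor. The family \<open>\<omega>\<close> represents the differential given in each chart
  \<open>c\<close> with coordinate \<open>z\<close> by \<open>\<omega> c x dz^m\<close>. A section is determined by its restriction to the
  complement of \<open>D\<close>, so only the values of \<open>\<omega> c\<close> on \<open>fst c - D\<close> matter.\<close>

definition H0_canonical_power ::
    "'a surface \<Rightarrow> 'a set \<Rightarrow> nat \<Rightarrow> int \<Rightarrow> ('a chart \<Rightarrow> 'a \<Rightarrow> complex) set" where
  "H0_canonical_power C D m n = {\<omega>.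
     (\<forall>c\<in>surface_atlas C. \<forall>d\<in>surface_atlas C. \<forall>x\<in>fst c \<inter> fst d - D.
        \<omega> c x = coord_deriv d c x ^ m * \<omega> d x) \<and>
     (\<forall>c\<in>surface_atlas C.
        (\<omega> c \<circ> chart_inv c) holomorphic_on (snd c ` (fst c - D)) \<and>
        (\<forall>p\<in>fst c \<inter> D. pole_order_le n (\<omega> c \<circ> chart_inv c) (snd c p)))}"

section \<open>The group $SO(2m)$, its Lie algebra, nilpotency, and the Pfaffian\<close>

definition SO_group :: "nat \<Rightarrow> complex mat set" where
  "SO_group m = {g \<in> carrier_mat (2 * m) (2 * m).
     transpose_mat g * g = 1\<^sub>m (2 * m) \<and> Determinant.det g = 1}"

definition so_algebra :: "nat \<Rightarrow> complex mat set" where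
  "so_algebra m = {X \<in> carrier_mat (2 * m) (2 * m). transpose_mat X = - X}"

definition lie_bracket :: "complex mat \<Rightarrow> complex mat \<Rightarrow> complex mat" where
  "lie_bracket X Y = X * Y - Y * X"

definition lie_centre :: "nat \<Rightarrow> complex mat set \<Rightarrow> complex mat set" where
  "lie_centre n L = {Z \<in> L. \<forall>X\<in>L. lie_bracket Z X = 0\<^sub>m n n}"

text \<open>The linear span of all brackets.\<close>

inductive_set lie_derived :: "complex mat set \<Rightarrow> complex mat set" for L where
  bracket: "X \<in> L \<Longrightarrow> Y \<in> L \<Longrightarrow> lie_bracket X Y \<in> lie_derived L"
| add: "A \<in> lie_derived L \<Longrightarrow> B \<in> lie_derived L \<Longrightarrow> A + B \<in> lie_derived L"
| smult: "A \<in> lie_derived L \<Longrightarrow> a \<cdot>\<^sub>m A \<in> lie_derived L"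

text \<open>Nilpotent elements of a reductive Lie algebra \<open>L\<close> of \<open>n \<times> n\<close> matrices: in the
  decomposition of \<open>L\<close> as the sum of its centre and its semisimple derived algebra, the central
  component vanishes and the other one is ad-nilpotent on the derived algebra.\<close>

definition reductive_nilpotent :: "nat \<Rightarrow> complex mat set \<Rightarrow> complex mat \<Rightarrow> bool" where
  "reductive_nilpotent n L N \<longleftrightarrow>
     (\<exists>Z\<in>lie_centre n L. \<exists>Y\<in>lie_derived L. N = Z + Y \<and> Z = 0\<^sub>m n n \<and>
        (\<exists>k. \<forall>X\<in>lie_derived L. (lie_bracket Y ^^ k) X = 0\<^sub>m n n))"

text \<open>The normalization is such that the Pfaffian of the block diagonal matrix with \<open>m\<close> blocks
  of rows \<open>(0, 1)\<close>, \<open>(-1, 0)\<close> is \<open>1\<close>.\<close>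

definition pfaffian :: "nat \<Rightarrow> complex mat \<Rightarrow> complex" where
  "pfaffian m A = (1 / (2 ^ m * fact m)) *
     (\<Sum>\<sigma> | \<sigma> permutes {..<2 * m}.
        of_int (sign \<sigma>) * (\<Prod>i<m. A $$ (\<sigma> (2 * i), \<sigma> (2 * i + 1))))"

section \<open>Holomorphic principal bundles and the adjoint bundle\<close>

text \<open>A local trivialization over an open set \<open>U\<close> is a pair \<open>(U, \<tau>)\<close>, where \<open>\<tau>\<close> is the group
  component of the equivariant bijection $p \mapsto (\pi(p), \tau(p))$ from $\pi^{-1}(U)$ to
  $U \times G$.\<close>

record ('a, 'p) principal_bundle =
  total_space :: "'p set"
  bundle_proj :: "'p \<Rightarrow> 'a"
  group_act :: "'p \<Rightarrow> complex mat \<Rightarrow> 'p"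
  trivializations :: "('a set \<times> ('p \<Rightarrow> complex mat)) set"

definition bundle_fibre :: "('a, 'p) principal_bundle \<Rightarrow> 'a \<Rightarrow> 'p set" where
  "bundle_fibre P x = {p \<in> total_space P. bundle_proj P p = x}"

text \<open>The local section on which the trivialization takes the value \<open>1\<close>.\<close>

definition local_frame ::
    "('a, 'p) principal_bundle \<Rightarrow> nat \<Rightarrow> 'a set \<times> ('p \<Rightarrow> complex mat) \<Rightarrow> 'a \<Rightarrow> 'p" where
  "local_frame P m t x = inv_into (bundle_fibre P x) (snd t) (1\<^sub>m (2 * m))"

text \<open>The complex manifold structure on the total space is the one for which all given
  trivializations are biholomorphic; it exists because the transition functions
  \<open>\<lambda>x. snd u (local_frame P m t x)\<close>, with values in the group, are holomorphic.\<close>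

definition holomorphic_principal_SO_bundle ::
    "'a surface \<Rightarrow> nat \<Rightarrow> ('a, 'p) principal_bundle \<Rightarrow> bool" where
  "holomorphic_principal_SO_bundle C m P \<longleftrightarrow>
     bundle_proj P ` total_space P \<subseteq> topspace (surface_top C) \<and>
     (\<forall>p\<in>total_space P. group_act P p (1\<^sub>m (2 * m)) = p \<and>
        (\<forall>g\<in>SO_group m. group_act P p g \<in> total_space P \<and>
           bundle_proj P (group_act P p g) = bundle_proj P p \<and>
           (\<forall>h\<in>SO_group m. group_act P (group_act P p g) h = group_act P p (g * h)))) \<and>
     (\<forall>t\<in>trivializations P. openin (surface_top C) (fst t) \<and>
        (\<forall>x\<in>fst t. bij_betw (snd t) (bundle_fibre P x) (SO_group m) \<and>
           (\<forall>p\<in>bundle_fibre P x. \<forall>g\<in>SO_group m. snd t (group_act P p g) = snd t p * g))) \<and>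
     (\<Union>t\<in>trivializations P. fst t) = topspace (surface_top C) \<and>
     (\<forall>t\<in>trivializations P. \<forall>u\<in>trivializations P. \<forall>i<2 * m. \<forall>j<2 * m.
        holomorphic_on_surface C (fst t \<inter> fst u) (\<lambda>x. snd u (local_frame P m t x) $$ (i, j)))"

text \<open>The element $[p, X]$ of $P \times^G \mathfrak{g}$, where
  $(p, X) \sim (p g, g^{-1} X g)$; the inverse of an orthogonal matrix is its transpose.\<close>

definition ad_class ::
    "('a, 'p) principal_bundle \<Rightarrow> nat \<Rightarrow> 'p \<Rightarrow> complex mat \<Rightarrow> ('p \<times> complex mat) set" where
  "ad_class P m p X = (\<lambda>g. (group_act P p g, transpose_mat g * X * g)) ` SO_group m"

definition ad_fibre ::
    "('a, 'p) principal_bundle \<Rightarrow> nat \<Rightarrow> 'a \<Rightarrow> ('p \<times> complex mat) set set" where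
  "ad_fibre P m x = {ad_class P m p X | p X. p \<in> bundle_fibre P x \<and> X \<in> so_algebra m}"

definition ad_scale :: "complex \<Rightarrow> ('p \<times> complex mat) set \<Rightarrow> ('p \<times> complex mat) set" where
  "ad_scale a v = (\<lambda>(p, X). (p, a \<cdot>\<^sub>m X)) ` v"

section \<open>Logarithmic Higgs fields\<close>

text \<open>A Higgs field \<open>\<Phi>\<close> assigns to a chart with coordinate \<open>z\<close> and a point \<open>x\<close> of its domain
  outside \<open>D\<close> the element \<open>\<Phi> c x\<close> of $\mathrm{ad}(P)_x$ such that the field is \<open>\<Phi> c x dz\<close>.\<close>

type_synonym ('a, 'p) higgs = "'a chart \<Rightarrow> 'a \<Rightarrow> ('p \<times> complex mat) set"

text \<open>The matrix \<open>s\<close> with $\Phi = s\,dz$ in the trivialization \<open>t\<close>.\<close>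

definition local_matrix ::
    "('a, 'p) principal_bundle \<Rightarrow> nat \<Rightarrow> ('a, 'p) higgs \<Rightarrow> 'a chart \<Rightarrow>
     'a set \<times> ('p \<Rightarrow> complex mat) \<Rightarrow> 'a \<Rightarrow> complex mat" where
  "local_matrix P m \<Phi> c t x =
     (THE X. X \<in> so_algebra m \<and> \<Phi> c x = ad_class P m (local_frame P m t x) X)"

definition log_SO_higgs_bundle ::
    "'a surface \<Rightarrow> 'a set \<Rightarrow> nat \<Rightarrow> ('a, 'p) principal_bundle \<Rightarrow> ('a, 'p) higgs \<Rightarrow> bool" where
  "log_SO_higgs_bundle C D m P \<Phi> \<longleftrightarrow>
     holomorphic_principal_SO_bundle C m P \<and>
     (\<forall>c\<in>surface_atlas C. \<forall>x\<in>fst c - D. \<Phi> c x \<in> ad_fibre P m x) \<and>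
     (\<forall>c\<in>surface_atlas C. \<forall>d\<in>surface_atlas C. \<forall>x\<in>fst c \<inter> fst d - D.
        \<Phi> c x = ad_scale (coord_deriv d c x) (\<Phi> d x)) \<and>
     (\<forall>c\<in>surface_atlas C. \<forall>t\<in>trivializations P. \<forall>i<2 * m. \<forall>j<2 * m.
        (\<lambda>w. local_matrix P m \<Phi> c t (chart_inv c w) $$ (i, j))
           holomorphic_on (snd c ` (fst c \<inter> fst t - D)) \<and>
        (\<forall>p\<in>fst c \<inter> fst t \<inter> D.
           pole_order_le 1 (\<lambda>w. local_matrix P m \<Phi> c t (chart_inv c w) $$ (i, j)) (snd c p)))"

text \<open>All matrices representing the residue at \<open>p\<close> in the charts and trivializations around \<open>p\<close>;
  they form a subset of one conjugacy class.\<close>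

definition residue_matrices ::
    "'a surface \<Rightarrow> nat \<Rightarrow> ('a, 'p) principal_bundle \<Rightarrow> ('a, 'p) higgs \<Rightarrow> 'a \<Rightarrow> complex mat set" where
  "residue_matrices C m P \<Phi> p =
     {Matrix.mat (2 * m) (2 * m)
        (\<lambda>(i, j). residue (\<lambda>w. local_matrix P m \<Phi> c t (chart_inv c w) $$ (i, j)) (snd c p)) | c t.
      c \<in> surface_atlas C \<and> t \<in> trivializations P \<and> p \<in> fst c \<inter> fst t}"

definition nilpotent_residues ::
    "'a surface \<Rightarrow> 'a set \<Rightarrow> nat \<Rightarrow> ('a, 'p) principal_bundle \<Rightarrow> ('a, 'p) higgs \<Rightarrow> bool" where
  "nilpotent_residues C D m P \<Phi> \<longleftrightarrow>
     (\<forall>p\<in>D. \<forall>N\<in>residue_matrices C m P \<Phi> p. reductive_nilpotent (2 * m) (so_algebra m) N)"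

text \<open>The coefficient of $dz^m$ in $\mathrm{Pf}(\Phi)$. It does not depend on the trivialization,
  since the Pfaffian is invariant under conjugation by the special orthogonal group.\<close>

definition higgs_pfaffian ::
    "nat \<Rightarrow> ('a, 'p) principal_bundle \<Rightarrow> ('a, 'p) higgs \<Rightarrow> 'a chart \<Rightarrow> 'a \<Rightarrow> complex" where
  "higgs_pfaffian m P \<Phi> c x =
     (THE y. \<exists>t\<in>trivializations P. x \<in> fst t \<and> y = pfaffian m (local_matrix P m \<Phi> c t x))"

end

theory Submission
  imports Defs "Jordan_Normal_Form.Spectral_Radius"
begin

text \<open>Near a point \<open>a\<close> of \<open>D\<close> the Higgs field is given by a skew-symmetric matrix
  $M(w) = H(w) / (w - a)$ with \<open>H\<close> holomorphic and $H(a) = N$ the residue, so that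
  $\mathrm{Pf}(M) = (w - a)^{-m}\, \mathrm{Pf}(H)$. The claim is that $\mathrm{Pf}(H)$ vanishes at \<open>a\<close> to
  order at least $d / 2$, where \<open>d\<close> is the dimension of the kernel of \<open>N\<close>.

  For an invertible constant matrix \<open>B\<close> one has
  $\mathrm{Pf}(B^T H B) = \det(B)\, \mathrm{Pf}(H)$ (lemma \<open>pfaffian_congruence\<close>), and \<open>B\<close> can be chosen
  so that \<open>d\<close> rows and the corresponding \<open>d\<close> columns of $B^T N B$ are zero (lemma
  \<open>so_algebra_congruence_vanishing\<close>). Each summand of the Pfaffian is a product over a partition of the
  indices into pairs, and at least $d / 2$ of the pairs contain one of these \<open>d\<close> indices; the
  corresponding factors vanish at \<open>a\<close> (lemma \<open>pfaffian_vanishing_order\<close>).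

  If the rank of \<open>N\<close> is at most \<open>2 * m - 4\<close>, then $d \geq 4$ and two orders are gained. If \<open>N\<close> is merely
  nilpotent, it is singular, so $d \geq 1$ and one order is gained. Here nilpotency means that
  $\mathrm{ad}(N)$ is nilpotent; that such a skew-symmetric matrix is singular is shown with the bivectors
  $v \wedge w$, where \<open>v\<close> is an eigenvector of \<open>N\<close> (lemma \<open>reductive_nilpotent_so_singular\<close>).

  Globally, the Pfaffian does not depend on the trivialization because transition functions have
  determinant \<open>1\<close>, and it transforms with the \<open>m\<close>-th power of the coordinate change because it is
  homogeneous of degree \<open>m\<close>.\<close>

section \<open>The Pfaffian under congruence\<close>

lemma prod_lessThan_double:
  fixes f :: "nat \<Rightarrow> 'a::comm_monoid_mult"
  shows "(\<Prod>j<2 * m. f j) = (\<Prod>i<m. f (2 * i) * f (2 * i + 1))"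
proof (induction m)
  case (Suc m)
  have "2 * Suc m = Suc (Suc (2 * m))" by simp
  then show ?case by (simp only: prod.lessThan_Suc Suc) (simp add: mult.assoc)
qed simp

text \<open>A family \<open>g\<close> of \<open>m\<close> pairs, read as the sequence
  \<open>fst (g 0), snd (g 0), fst (g 1), snd (g 1), \<dots>\<close> of length \<open>2 * m\<close>. Beyond that length the function
  is the identity, so that it satisfies \<open>permutes\<close> if the sequence lists all indices below \<open>2 * m\<close>.\<close>

definition unpair :: "nat \<Rightarrow> (nat \<Rightarrow> nat \<times> nat) \<Rightarrow> nat \<Rightarrow> nat" where
  "unpair m g j =
     (if j < 2 * m then (if even j then fst else snd) (g (j div 2)) else j)"

lemma unpair_even [simp]: "i < m \<Longrightarrow> unpair m g (2 * i) = fst (g i)"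
  and unpair_odd [simp]: "i < m \<Longrightarrow> unpair m g (Suc (2 * i)) = snd (g i)"
  by (auto simp: unpair_def)

lemma unpair_less:
  assumes "g \<in> {..<m} \<rightarrow>\<^sub>E {..<2 * m} \<times> {..<2 * m}" "j < 2 * m"
  shows "unpair m g j < 2 * m"
proof -
  have "g (j div 2) \<in> {..<2 * m} \<times> {..<2 * m}" using assms by (intro PiE_mem[OF assms(1)]) auto
  then obtain a b where "g (j div 2) = (a, b)" "a < 2 * m" "b < 2 * m" by auto
  then show ?thesis using assms(2) by (simp add: unpair_def)
qed

lemma unpair_permutes_iff:
  assumes "g \<in> {..<m} \<rightarrow>\<^sub>E {..<2 * m} \<times> {..<2 * m}"
  shows "unpair m g permutes {..<2 * m} \<longleftrightarrow> inj_on (unpair m g) {..<2 * m}"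
proof
  assume "unpair m g permutes {..<2 * m}"
  then show "inj_on (unpair m g) {..<2 * m}" by (rule permutes_inj_on)
next
  assume i: "inj_on (unpair m g) {..<2 * m}"
  show "unpair m g permutes {..<2 * m}"
  proof (rule inj_imp_permutes[OF i])
    fix j
    show "j \<in> {..<2 * m} \<Longrightarrow> unpair m g j \<in> {..<2 * m}" using unpair_less[OF assms] by simp
    show "j \<notin> {..<2 * m} \<Longrightarrow> unpair m g j = j" by (simp add: unpair_def)
  qed simp
qed

text \<open>The left-hand side is the determinant of the matrix whose rows are the rows of \<open>B\<close> listed by
  \<open>unpair m g\<close>; it vanishes if a row is listed twice.\<close>

lemma det_rows_unpair:
  fixes B :: "complex mat"
  assumes B: "B \<in> carrier_mat (2 * m) (2 * m)"
    and g: "g \<in> {..<m} \<rightarrow>\<^sub>E {..<2 * m} \<times> {..<2 * m}"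
  shows "(\<Sum>\<sigma> | \<sigma> permutes {..<2 * m}. of_int (sign \<sigma>) * (\<Prod>j<2 * m. B $$ (unpair m g j, \<sigma> j))) =
    (if unpair m g permutes {..<2 * m} then of_int (sign (unpair m g)) * Determinant.det B else 0)"
proof -
  let ?M = "Matrix.mat (2 * m) (2 * m) (\<lambda>(i, j). B $$ (unpair m g i, j))"
  have "(\<Sum>\<sigma> | \<sigma> permutes {..<2 * m}. of_int (sign \<sigma>) * (\<Prod>j<2 * m. B $$ (unpair m g j, \<sigma> j))) =
      Determinant.det ?M"
    unfolding lessThan_atLeast0
    by (subst det_def'[of _ "2 * m"], simp)
      (intro sum.cong refl arg_cong2[where f = "(*)"] prod.cong, auto simp: permutes_in_image)
  also have "\<dots> = (if unpair m g permutes {..<2 * m} then of_int (sign (unpair m g)) * Determinant.det B else 0)"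
  proof (cases "unpair m g permutes {..<2 * m}")
    case True
    then show ?thesis using det_permute_rows[OF B, of "unpair m g"] by (simp add: lessThan_atLeast0)
  next
    case False
    then obtain a b where ab: "a < 2 * m" "b < 2 * m" "a \<noteq> b" "unpair m g a = unpair m g b"
      unfolding unpair_permutes_iff[OF g] inj_on_def by auto
    have "Determinant.det ?M = 0"
      by (rule det_identical_rows[of _ "2 * m" a b]) (use ab in \<open>auto intro!: eq_vecI\<close>)
    with False show ?thesis by simp
  qed
  finally show ?thesis .
qed

lemma congruence_entry:
  fixes A B :: "'a::comm_semiring_0 mat"
  assumes A: "A \<in> carrier_mat n n" and B: "B \<in> carrier_mat n n" and "a < n" "b < n"
  shows "(transpose_mat B * A * B) $$ (a, b) =
    (\<Sum>q\<in>{..<n} \<times> {..<n}. A $$ q * (B $$ (fst q, a) * B $$ (snd q, b)))"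
proof -
  have "(transpose_mat B * A * B) $$ (a, b) =
      (\<Sum>l<n. (\<Sum>k<n. B $$ (k, a) * A $$ (k, l)) * B $$ (l, b))"
    using assms by (auto simp: scalar_prod_def lessThan_atLeast0 simp del: assoc_mult_mat intro!: sum.cong)
  also have "\<dots> = (\<Sum>k<n. \<Sum>l<n. A $$ (k, l) * (B $$ (k, a) * B $$ (l, b)))"
    unfolding sum_distrib_right by (subst sum.swap) (simp add: mult_ac)
  finally show ?thesis by (simp add: sum.cartesian_product case_prod_unfold)
qed

text \<open>No skew-symmetry is needed. Expanding each entry of $B^T A B$ turns each product in the
  Pfaffian into a sum over all families \<open>g\<close> of \<open>m\<close> index pairs; the alternating sum over \<open>\<sigma>\<close> is then
  a determinant of rows of \<open>B\<close>, and only the families that list every index once survive.\<close>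

lemma pfaffian_congruence:
  assumes A: "A \<in> carrier_mat (2 * m) (2 * m)" and B: "B \<in> carrier_mat (2 * m) (2 * m)"
  shows "pfaffian m (transpose_mat B * A * B) = Determinant.det B * pfaffian m A"
proof -
  let ?S = "{\<sigma>. \<sigma> permutes {..<2 * m}}"
  let ?G = "{..<m} \<rightarrow>\<^sub>E {..<2 * m} \<times> {..<2 * m}"
  let ?C = "transpose_mat B * A * B"
  have expand: "(\<Prod>i<m. ?C $$ (\<sigma> (2 * i), \<sigma> (2 * i + 1))) =
      (\<Sum>g\<in>?G. (\<Prod>i<m. A $$ g i) * (\<Prod>j<2 * m. B $$ (unpair m g j, \<sigma> j)))"
    if \<sigma>: "\<sigma> permutes {..<2 * m}" for \<sigma>
  proof -
    have "\<sigma> j < 2 * m" if "j < 2 * m" for j using permutes_in_image[OF \<sigma>, of j] that by simp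
    then have "(\<Prod>i<m. ?C $$ (\<sigma> (2 * i), \<sigma> (2 * i + 1))) =
        (\<Prod>i<m. \<Sum>q\<in>{..<2 * m} \<times> {..<2 * m}.
           A $$ q * (B $$ (fst q, \<sigma> (2 * i)) * B $$ (snd q, \<sigma> (2 * i + 1))))"
      by (intro prod.cong refl congruence_entry[OF A B]) auto
    also have "\<dots> = (\<Sum>g\<in>?G. \<Prod>i<m.
        A $$ g i * (B $$ (fst (g i), \<sigma> (2 * i)) * B $$ (snd (g i), \<sigma> (2 * i + 1))))"
      by (rule prod_sum_PiE) auto
    also have "\<dots> = (\<Sum>g\<in>?G. (\<Prod>i<m. A $$ g i) * (\<Prod>j<2 * m. B $$ (unpair m g j, \<sigma> j)))"
      unfolding prod_lessThan_double by (simp add: prod.distrib)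
    finally show ?thesis .
  qed
  have "(\<Sum>\<sigma>\<in>?S. of_int (sign \<sigma>) * (\<Prod>i<m. ?C $$ (\<sigma> (2 * i), \<sigma> (2 * i + 1)))) =
      (\<Sum>\<sigma>\<in>?S. of_int (sign \<sigma>) *
         (\<Sum>g\<in>?G. (\<Prod>i<m. A $$ g i) * (\<Prod>j<2 * m. B $$ (unpair m g j, \<sigma> j))))"
    by (intro sum.cong refl) (simp only: expand mem_Collect_eq)
  also have "\<dots> = (\<Sum>\<sigma>\<in>?S. \<Sum>g\<in>?G. (\<Prod>i<m. A $$ g i) *
      (of_int (sign \<sigma>) * (\<Prod>j<2 * m. B $$ (unpair m g j, \<sigma> j))))"
    by (simp only: sum_distrib_left mult.left_commute)
  also have "\<dots> = (\<Sum>g\<in>?G. \<Sum>\<sigma>\<in>?S. (\<Prod>i<m. A $$ g i) *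
      (of_int (sign \<sigma>) * (\<Prod>j<2 * m. B $$ (unpair m g j, \<sigma> j))))"
    by (rule sum.swap)
  also have "\<dots> = (\<Sum>g\<in>?G. (\<Prod>i<m. A $$ g i) *
      (\<Sum>\<sigma>\<in>?S. of_int (sign \<sigma>) * (\<Prod>j<2 * m. B $$ (unpair m g j, \<sigma> j))))"
    by (simp only: sum_distrib_left)
  also have "\<dots> = (\<Sum>g\<in>?G. if unpair m g permutes {..<2 * m}
      then (\<Prod>i<m. A $$ g i) * (of_int (sign (unpair m g)) * Determinant.det B) else 0)"
    by (intro sum.cong refl) (simp add: det_rows_unpair[OF B])
  also have "\<dots> = (\<Sum>g | g \<in> ?G \<and> unpair m g permutes {..<2 * m}.
      (\<Prod>i<m. A $$ g i) * (of_int (sign (unpair m g)) * Determinant.det B))"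
    by (rule sum.inter_filter[symmetric]) (simp add: finite_PiE)
  also have "\<dots> = (\<Sum>\<sigma>\<in>?S. (\<Prod>i<m. A $$ (\<sigma> (2 * i), \<sigma> (2 * i + 1))) *
      (of_int (sign \<sigma>) * Determinant.det B))"
  proof (rule sum.reindex_bij_witness
      [where i = "\<lambda>\<sigma>. \<lambda>i\<in>{..<m}. (\<sigma> (2 * i), \<sigma> (2 * i + 1))" and j = "unpair m"])
    fix g assume g: "g \<in> {g \<in> ?G. unpair m g permutes {..<2 * m}}"
    show "(\<lambda>i\<in>{..<m}. (unpair m g (2 * i), unpair m g (2 * i + 1))) = g"
    proof (rule extensionalityI[of _ "{..<m}"])
      show "g \<in> extensional {..<m}" using g by (simp add: PiE_iff)
    qed simp_all
    show "unpair m g \<in> ?S" using g by simp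
    show "(\<Prod>i<m. A $$ (unpair m g (2 * i), unpair m g (2 * i + 1))) *
        (of_int (sign (unpair m g)) * Determinant.det B) =
        (\<Prod>i<m. A $$ g i) * (of_int (sign (unpair m g)) * Determinant.det B)" by simp
  next
    fix \<sigma> assume "\<sigma> \<in> ?S"
    then have \<sigma>: "\<sigma> permutes {..<2 * m}" by simp
    have "unpair m (\<lambda>i\<in>{..<m}. (\<sigma> (2 * i), \<sigma> (2 * i + 1))) j = \<sigma> j" for j
    proof (cases "j < 2 * m")
      case True
      then have "j div 2 < m" by simp
      then show ?thesis using True by (cases "even j") (simp_all add: unpair_def)
    next
      case False
      then show ?thesis using permutes_not_in[OF \<sigma>, of j] by (simp add: unpair_def)
    qed
    then show eq: "unpair m (\<lambda>i\<in>{..<m}. (\<sigma> (2 * i), \<sigma> (2 * i + 1))) = \<sigma>" by blast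
    have "\<sigma> j < 2 * m" if "j < 2 * m" for j using permutes_in_image[OF \<sigma>, of j] that by simp
    then show "(\<lambda>i\<in>{..<m}. (\<sigma> (2 * i), \<sigma> (2 * i + 1))) \<in>
        {g \<in> ?G. unpair m g permutes {..<2 * m}}"
      using \<sigma> eq by (simp add: PiE_def Pi_def)
  qed
  finally show ?thesis unfolding pfaffian_def by (simp only: sum_distrib_left mult_ac)
qed

lemma pfaffian_smult:
  assumes "A \<in> carrier_mat (2 * m) (2 * m)"
  shows "pfaffian m (a \<cdot>\<^sub>m A) = a ^ m * pfaffian m A"
proof -
  have "(\<Prod>i<m. (a \<cdot>\<^sub>m A) $$ (\<sigma> (2 * i), \<sigma> (2 * i + 1))) =
      a ^ m * (\<Prod>i<m. A $$ (\<sigma> (2 * i), \<sigma> (2 * i + 1)))" if \<sigma>: "\<sigma> permutes {..<2 * m}" for \<sigma>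
  proof -
    have "\<sigma> j < 2 * m" if "j < 2 * m" for j using permutes_in_image[OF \<sigma>, of j] that by simp
    then show ?thesis using assms by (simp add: prod.distrib)
  qed
  then show ?thesis unfolding pfaffian_def by (simp add: sum_distrib_left mult_ac)
qed

section \<open>Skew-symmetric matrices of small rank\<close>

text \<open>Every column is a linear combination of the columns in a suitable set \<open>I\<close> of \<open>rank A\<close> positions;
  \<open>c k j\<close> is the coefficient of column \<open>k\<close> in column \<open>j\<close>.\<close>

lemma rank_columns:
  fixes A :: "complex mat"
  assumes A: "A \<in> carrier_mat n nc"
  obtains I c where "I \<subseteq> {..<nc}" "card I = vec_space.rank n A"
    "\<And>i j. i < n \<Longrightarrow> j < nc \<Longrightarrow> A $$ (i, j) = (\<Sum>k\<in>I. A $$ (i, k) * c k j)"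
proof -
  interpret vec_space "TYPE(complex)" n .
  let ?P = "\<lambda>T. T \<subseteq> set (cols A) \<and> lin_indpt T"
  obtain S where S: "maximal S ?P"
    using maximal_exists_superset[of "set (cols A)" ?P "{}"] finite_lin_indpt2[of "{}"] by auto
  have rank: "rank A = card S" by (rule rank_card_indpt[OF A S])
  have sub: "S \<subseteq> set (cols A)" and indpt: "lin_indpt S" using S by (auto simp: maximal_def)
  have cols: "set (cols A) \<subseteq> carrier_vec n" using cols_dim[of A] A by auto
  have fin: "finite S" using sub finite_subset by blast
  have SV: "S \<subseteq> carrier_vec n" using sub cols by auto
  have span: "v \<in> span S" if "v \<in> set (cols A)" for v
  proof (cases "v \<in> S")
    case True
    then show ?thesis using in_own_span[OF SV] by auto
  next
    case False
    have "\<not> ?P (S \<union> {v})" using S False unfolding maximal_def by blast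
    then have "lin_dep (S \<union> {v})" using sub that by auto
    moreover have "v \<in> carrier_vec n" using that cols by auto
    ultimately show ?thesis using lin_dep_iff_in_span[of S v] SV indpt False by auto
  qed
  \<comment> \<open>Each vector of \<open>S\<close> may occur as a column several times; \<open>ix\<close> selects one position.\<close>
  define ix where "ix = (\<lambda>s. SOME k. k < nc \<and> col A k = s)"
  have ix: "ix s < nc \<and> col A (ix s) = s" if "s \<in> S" for s
  proof -
    have "s \<in> col A ` {0..<nc}" using sub that A by (auto simp: cols_def)
    then have "\<exists>k. k < nc \<and> col A k = s" by auto
    then show ?thesis unfolding ix_def by (rule someI_ex)
  qed
  have inj: "inj_on ix S" by (rule inj_on_inverseI[of _ "col A"]) (use ix in auto)
  have "\<exists>a. lincomb a S = col A j" if "j < nc" for j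
    using finite_in_span[OF fin _ span[of "col A j"]] SV that A by (auto simp: cols_def)
  then obtain a where a: "\<And>j. j < nc \<Longrightarrow> lincomb (a j) S = col A j" by metis
  show ?thesis
  proof
    show "ix ` S \<subseteq> {..<nc}" using ix by auto
    show "card (ix ` S) = rank A" using card_image[OF inj] rank by simp
    fix i j assume ij: "i < n" "j < nc"
    have "A $$ (i, j) = col A j $ i" using A ij by auto
    also have "\<dots> = lincomb (a j) S $ i" using a ij by simp
    also have "\<dots> = (\<Sum>s\<in>S. a j s * s $ i)" by (rule lincomb_index[OF ij(1) SV])
    also have "\<dots> = (\<Sum>s\<in>S. A $$ (i, ix s) * a j (col A (ix s)))"
    proof (rule sum.cong[OF refl])
      fix s assume s: "s \<in> S"
      have "s $ i = col A (ix s) $ i" using ix[OF s] by simp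
      also have "\<dots> = A $$ (i, ix s)" using A ij conjunct1[OF ix[OF s]] by simp
      finally show "a j s * s $ i = A $$ (i, ix s) * a j (col A (ix s))" using ix[OF s] by simp
    qed
    also have "\<dots> = (\<Sum>k\<in>ix ` S. A $$ (i, k) * a j (col A k))"
      using inj by (simp add: sum.reindex)
    finally show "A $$ (i, j) = (\<Sum>k\<in>ix ` S. A $$ (i, k) * a j (col A k))" .
  qed
qed

text \<open>Column operations that subtract from each dependent column its expression in the independent
  ones. The operations form a matrix $1 - M$ with $M^2 = 0$, so it is invertible.\<close>

lemma invertible_annihilating_columns:
  fixes A :: "complex mat"
  assumes A: "A \<in> carrier_mat n n"
  obtains B Z where "B \<in> carrier_mat n n" "Determinant.det B \<noteq> 0" "Z \<subseteq> {..<n}"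
    "card Z = n - vec_space.rank n A" "\<And>i j. i < n \<Longrightarrow> j \<in> Z \<Longrightarrow> (A * B) $$ (i, j) = 0"
proof -
  obtain I c where I: "I \<subseteq> {..<n}" "card I = vec_space.rank n A"
    and c: "\<And>i j. i < n \<Longrightarrow> j < n \<Longrightarrow> A $$ (i, j) = (\<Sum>k\<in>I. A $$ (i, k) * c k j)"
    using rank_columns[OF A] by blast
  define M where "M = Matrix.mat n n (\<lambda>(k, j). if k \<in> I \<and> j \<notin> I then c k j else 0)"
  have M: "M \<in> carrier_mat n n" by (simp add: M_def)
  have M2: "M * M = 0\<^sub>m n n"
    by (rule eq_matI) (auto simp: M_def scalar_prod_def intro!: sum.neutral)
  show ?thesis
  proof
    show B: "1\<^sub>m n - M \<in> carrier_mat n n" using M by (rule minus_carrier_mat)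
    have "(1\<^sub>m n - M) * (1\<^sub>m n + M) = 1\<^sub>m n"
    proof -
      have "(1\<^sub>m n - M) * (1\<^sub>m n + M) = 1\<^sub>m n * (1\<^sub>m n + M) - M * (1\<^sub>m n + M)"
        using M by (intro minus_mult_distrib_mat) auto
      also have "M * (1\<^sub>m n + M) = M * 1\<^sub>m n + M * M"
        using M by (intro mult_add_distrib_mat) auto
      also have "1\<^sub>m n * (1\<^sub>m n + M) - (M * 1\<^sub>m n + M * M) = 1\<^sub>m n"
        using M unfolding M2 by (intro eq_matI) auto
      finally show ?thesis .
    qed
    then have "Determinant.det (1\<^sub>m n - M) * Determinant.det (1\<^sub>m n + M) = 1"
      using det_mult[OF B, of "1\<^sub>m n + M"] M by simp
    then show "Determinant.det (1\<^sub>m n - M) \<noteq> 0" by auto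
    show "{..<n} - I \<subseteq> {..<n}" by auto
    show "card ({..<n} - I) = n - vec_space.rank n A"
      using I by (simp add: card_Diff_subset finite_subset)
    fix i j assume i: "i < n" and j: "j \<in> {..<n} - I"
    have "(A * (1\<^sub>m n - M)) $$ (i, j) =
        (\<Sum>k<n. A $$ (i, k) * (if k = j then 1 else 0)) - (\<Sum>k<n. if k \<in> I then A $$ (i, k) * c k j else 0)"
      using A i j by (auto simp: scalar_prod_def M_def lessThan_atLeast0 right_diff_distrib
          sum_subtractf[symmetric] intro!: sum.cong)
    also have "(\<Sum>k<n. A $$ (i, k) * (if k = j then 1 else 0)) = A $$ (i, j)"
      using j by (simp add: sum.delta if_distrib cong: if_cong)
    also have "(\<Sum>k<n. if k \<in> I then A $$ (i, k) * c k j else 0) = (\<Sum>k\<in>I. A $$ (i, k) * c k j)"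
      using I(1) by (simp add: sum.If_cases Int_absorb1)
    finally show "(A * (1\<^sub>m n - M)) $$ (i, j) = 0" using c[of i j] i j by auto
  qed
qed

lemma so_algebra_iff:
  "X \<in> so_algebra m \<longleftrightarrow> X \<in> carrier_mat (2 * m) (2 * m) \<and>
     (\<forall>i<2 * m. \<forall>j<2 * m. X $$ (i, j) = - X $$ (j, i))"
proof (cases "X \<in> carrier_mat (2 * m) (2 * m)")
  case True
  have "transpose_mat X = - X \<longleftrightarrow> (\<forall>i<2 * m. \<forall>j<2 * m. X $$ (j, i) = - X $$ (i, j))"
    using True by (auto simp: mat_eq_iff)
  then show ?thesis using True by (auto simp: so_algebra_def)
qed (simp add: so_algebra_def)

lemma so_algebra_carrier: "X \<in> so_algebra m \<Longrightarrow> X \<in> carrier_mat (2 * m) (2 * m)"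
  by (simp add: so_algebra_def)

lemma so_algebra_skew:
  "X \<in> so_algebra m \<Longrightarrow> i < 2 * m \<Longrightarrow> j < 2 * m \<Longrightarrow> X $$ (i, j) = - X $$ (j, i)"
  unfolding so_algebra_iff by blast

lemma so_algebraI:
  assumes "X \<in> carrier_mat (2 * m) (2 * m)"
    and "\<And>i j. i < 2 * m \<Longrightarrow> j < 2 * m \<Longrightarrow> X $$ (i, j) = - X $$ (j, i)"
  shows "X \<in> so_algebra m"
  unfolding so_algebra_iff using assms by blast

lemma so_algebra_smult:
  assumes "X \<in> so_algebra m" shows "a \<cdot>\<^sub>m X \<in> so_algebra m"
proof (rule so_algebraI)
  fix i j assume ij: "i < 2 * m" "j < 2 * m"
  show "(a \<cdot>\<^sub>m X) $$ (i, j) = - (a \<cdot>\<^sub>m X) $$ (j, i)"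
    using so_algebra_carrier[OF assms] ij so_algebra_skew[OF assms ij] by simp
qed (use so_algebra_carrier[OF assms] in simp)

lemma so_algebra_congruence:
  assumes X: "X \<in> so_algebra m" and B: "B \<in> carrier_mat (2 * m) (2 * m)"
  shows "transpose_mat B * X * B \<in> so_algebra m"
proof -
  have X': "X \<in> carrier_mat (2 * m) (2 * m)" "transpose_mat X = - X"
    using X by (auto simp: so_algebra_def)
  have "transpose_mat (transpose_mat B * X * B) = transpose_mat B * (transpose_mat X * B)"
    using X' B by (simp add: transpose_mult[of _ "2 * m" "2 * m" _ "2 * m"])
  also have "\<dots> = - (transpose_mat B * X * B)"
    using X' B by (simp add: uminus_mult_left_mat uminus_mult_right_mat)
  finally show ?thesis using X' B by (auto simp: so_algebra_def)
qed

text \<open>By skew-symmetry the column operations applied on both sides clear rows as well as columns.\<close>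

lemma so_algebra_congruence_vanishing:
  assumes X: "X \<in> so_algebra m"
  obtains B Z where "B \<in> carrier_mat (2 * m) (2 * m)" "Determinant.det B \<noteq> 0" "Z \<subseteq> {..<2 * m}"
    "card Z = 2 * m - vec_space.rank (2 * m) X"
    "\<And>i j. i < 2 * m \<Longrightarrow> j < 2 * m \<Longrightarrow> i \<in> Z \<or> j \<in> Z \<Longrightarrow>
       (transpose_mat B * X * B) $$ (i, j) = 0"
proof -
  have X': "X \<in> carrier_mat (2 * m) (2 * m)" using X by (simp add: so_algebra_def)
  obtain B Z where B: "B \<in> carrier_mat (2 * m) (2 * m)" and "Determinant.det B \<noteq> 0"
    and Z: "Z \<subseteq> {..<2 * m}" and "card Z = 2 * m - vec_space.rank (2 * m) X"
    and XB: "\<And>i j. i < 2 * m \<Longrightarrow> j \<in> Z \<Longrightarrow> (X * B) $$ (i, j) = 0"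
    using invertible_annihilating_columns[OF X'] by blast
  let ?C = "transpose_mat B * X * B"
  have col: "?C $$ (i, j) = 0" if "i < 2 * m" "j \<in> Z" for i j
  proof -
    have "j < 2 * m" using that Z by auto
    have "?C = transpose_mat B * (X * B)" using B X' by simp
    then have "?C $$ (i, j) = (\<Sum>k<2 * m. B $$ (k, i) * (X * B) $$ (k, j))"
      using that \<open>j < 2 * m\<close> B X'
      by (auto simp: scalar_prod_def lessThan_atLeast0 simp del: assoc_mult_mat intro!: sum.cong)
    then show ?thesis using XB that by simp
  qed
  moreover have "?C $$ (i, j) = 0" if "i \<in> Z" "j < 2 * m" for i j
  proof -
    have "i < 2 * m" using that Z by auto
    then show ?thesis using so_algebra_skew[OF so_algebra_congruence[OF X B], of i j] col[of j i] that
      by simp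
  qed
  ultimately show ?thesis using that B \<open>Determinant.det B \<noteq> 0\<close> Z \<open>card Z = _\<close> by blast
qed

section \<open>Order of vanishing of the Pfaffian\<close>

lemma holomorphic_zero_factor:
  assumes "f holomorphic_on S" "open S" "f a = 0"
  obtains q where "q holomorphic_on S" "\<And>w. f w = (w - a) * q w"
proof
  show "(\<lambda>z. if z = a then deriv f a else (f z - f a) / (z - a)) holomorphic_on S"
    by (rule pole_lemma_open[OF assms(1,2)])
  show "f w = (w - a) * (if w = a then deriv f a else (f w - f a) / (w - a))" for w
    using assms(3) by simp
qed

text \<open>A set \<open>Z\<close> of indices meets at least half as many blocks $\{\sigma(2i), \sigma(2i+1)\}$ as it
  has elements.\<close>

lemma card_pairs_meeting:
  fixes m :: nat
  assumes \<sigma>: "\<sigma> permutes {..<2 * m}" and Z: "Z \<subseteq> {..<2 * m}"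
  shows "card Z \<le> 2 * card {i \<in> {..<m}. \<sigma> (2 * i) \<in> Z \<or> \<sigma> (2 * i + 1) \<in> Z}"
proof -
  let ?I = "{i \<in> {..<m}. \<sigma> (2 * i) \<in> Z \<or> \<sigma> (2 * i + 1) \<in> Z}"
  have "Z \<subseteq> (\<Union>i\<in>?I. {\<sigma> (2 * i), \<sigma> (2 * i + 1)})"
  proof
    fix z assume z: "z \<in> Z"
    then have "z \<in> \<sigma> ` {..<2 * m}" using permutes_image[OF \<sigma>] Z by auto
    then obtain j where j: "j < 2 * m" "z = \<sigma> j" by auto
    have "j = 2 * (j div 2) \<or> j = 2 * (j div 2) + 1" by presburger
    moreover have "j div 2 < m" using j by simp
    ultimately show "z \<in> (\<Union>i\<in>?I. {\<sigma> (2 * i), \<sigma> (2 * i + 1)})"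
      using z j(2) by (intro UN_I[of "j div 2"]) auto
  qed
  then have "card Z \<le> card (\<Union>i\<in>?I. {\<sigma> (2 * i), \<sigma> (2 * i + 1)})"
    by (intro card_mono) auto
  also have "\<dots> \<le> (\<Sum>i\<in>?I. card {\<sigma> (2 * i), \<sigma> (2 * i + 1)})" by (rule card_UN_le) simp
  also have "\<dots> \<le> (\<Sum>i\<in>?I. 2)" by (intro sum_mono) (simp add: card_insert_if)
  finally show ?thesis by simp
qed

text \<open>Every summand of the Pfaffian contains at least \<open>card Z / 2\<close> entries from the rows and columns
  indexed by \<open>Z\<close>, and each of these entries vanishes at \<open>a\<close>.\<close>

lemma pfaffian_vanishing_order:
  fixes F :: "complex \<Rightarrow> complex mat"
  assumes "open S"
    and dim: "\<And>w. F w \<in> carrier_mat (2 * m) (2 * m)"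
    and hol: "\<And>i j. i < 2 * m \<Longrightarrow> j < 2 * m \<Longrightarrow> (\<lambda>w. F w $$ (i, j)) holomorphic_on S"
    and van: "\<And>i j. i < 2 * m \<Longrightarrow> j < 2 * m \<Longrightarrow> i \<in> Z \<or> j \<in> Z \<Longrightarrow> F a $$ (i, j) = 0"
    and Z: "Z \<subseteq> {..<2 * m}" and k: "2 * k \<le> card Z + 1"
  obtains h where "h holomorphic_on S" "\<And>w. pfaffian m (F w) = (w - a) ^ k * h w"
proof -
  define e where "e = (\<lambda>i j. if i \<in> Z \<or> j \<in> Z then 1 else 0 :: nat)"
  have "\<exists>q. q holomorphic_on S \<and> (\<forall>w. F w $$ (i, j) = (w - a) ^ e i j * q w)"
    if ij: "i < 2 * m" "j < 2 * m" for i j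
  proof (cases "i \<in> Z \<or> j \<in> Z")
    case True
    obtain q where "q holomorphic_on S" "\<And>w. F w $$ (i, j) = (w - a) * q w"
      using holomorphic_zero_factor[OF hol[OF ij] assms(1) van[OF ij True]] by blast
    moreover have "e i j = 1" using True by (simp add: e_def)
    ultimately show ?thesis by auto
  next
    case False
    then have "e i j = 0" by (simp add: e_def)
    then show ?thesis using hol[OF ij] by (intro exI[of _ "\<lambda>w. F w $$ (i, j)"]) simp
  qed
  then obtain q where q_hol: "\<And>i j. i < 2 * m \<Longrightarrow> j < 2 * m \<Longrightarrow> q i j holomorphic_on S"
    and q: "\<And>i j w. i < 2 * m \<Longrightarrow> j < 2 * m \<Longrightarrow> F w $$ (i, j) = (w - a) ^ e i j * q i j w"
    by metis
  \<comment> \<open>\<open>E \<sigma>\<close> is the number of factors \<open>w - a\<close> split off from the summand of \<open>\<sigma>\<close>.\<close>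
  define E where "E = (\<lambda>\<sigma>. \<Sum>i<m. e (\<sigma> (2 * i)) (\<sigma> (2 * i + 1)))"
  define h where "h = (\<lambda>w. (1 / (2 ^ m * fact m)) * (\<Sum>\<sigma> | \<sigma> permutes {..<2 * m}.
      of_int (sign \<sigma>) * ((w - a) ^ (E \<sigma> - k) * (\<Prod>i<m. q (\<sigma> (2 * i)) (\<sigma> (2 * i + 1)) w))))"
  have less: "\<sigma> j < 2 * m" if "\<sigma> permutes {..<2 * m}" "j < 2 * m" for \<sigma> j
    using permutes_in_image[OF that(1), of j] that(2) by simp
  have E: "k \<le> E \<sigma>" if \<sigma>: "\<sigma> permutes {..<2 * m}" for \<sigma>
  proof -
    have "E \<sigma> = card {i \<in> {..<m}. \<sigma> (2 * i) \<in> Z \<or> \<sigma> (2 * i + 1) \<in> Z}"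
      unfolding E_def e_def by (simp add: sum.If_cases Collect_conj_eq lessThan_def)
    then show ?thesis using card_pairs_meeting[OF \<sigma> Z] k by simp
  qed
  show ?thesis
  proof
    show "h holomorphic_on S"
    proof -
      have "(\<lambda>w. \<Prod>i<m. q (\<sigma> (2 * i)) (\<sigma> (2 * i + 1)) w) holomorphic_on S"
        if \<sigma>: "\<sigma> permutes {..<2 * m}" for \<sigma>
        by (intro holomorphic_on_prod q_hol less[OF \<sigma>]) simp_all
      then show ?thesis
        unfolding h_def
        by (intro holomorphic_on_mult holomorphic_on_const holomorphic_on_sum holomorphic_on_power
            holomorphic_on_diff holomorphic_on_ident) simp
    qed
    fix w
    have "(\<Prod>i<m. F w $$ (\<sigma> (2 * i), \<sigma> (2 * i + 1))) =
        (w - a) ^ k * ((w - a) ^ (E \<sigma> - k) * (\<Prod>i<m. q (\<sigma> (2 * i)) (\<sigma> (2 * i + 1)) w))"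
      if \<sigma>: "\<sigma> permutes {..<2 * m}" for \<sigma>
    proof -
      have "(\<Prod>i<m. F w $$ (\<sigma> (2 * i), \<sigma> (2 * i + 1))) =
          (\<Prod>i<m. (w - a) ^ e (\<sigma> (2 * i)) (\<sigma> (2 * i + 1)) * q (\<sigma> (2 * i)) (\<sigma> (2 * i + 1)) w)"
        by (intro prod.cong refl q less[OF \<sigma>]) auto
      also have "\<dots> = (w - a) ^ E \<sigma> * (\<Prod>i<m. q (\<sigma> (2 * i)) (\<sigma> (2 * i + 1)) w)"
        by (simp only: prod.distrib E_def power_sum)
      also have "(w - a) ^ E \<sigma> = (w - a) ^ k * (w - a) ^ (E \<sigma> - k)"
        using E[OF \<sigma>] by (simp add: power_add[symmetric])
      finally show ?thesis by (simp only: mult.assoc)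
    qed
    note expand = this
    have "(\<Sum>\<sigma> | \<sigma> permutes {..<2 * m}.
          of_int (sign \<sigma>) * (\<Prod>i<m. F w $$ (\<sigma> (2 * i), \<sigma> (2 * i + 1)))) =
        (w - a) ^ k * (\<Sum>\<sigma> | \<sigma> permutes {..<2 * m}. of_int (sign \<sigma>) *
          ((w - a) ^ (E \<sigma> - k) * (\<Prod>i<m. q (\<sigma> (2 * i)) (\<sigma> (2 * i + 1)) w)))"
      unfolding sum_distrib_left
      by (intro sum.cong refl) (simp only: expand mem_Collect_eq mult.left_commute)
    then show "pfaffian m (F w) = (w - a) ^ k * h w"
      by (simp only: pfaffian_def h_def mult.left_commute)
  qed
qed

section \<open>Nilpotent elements of the orthogonal Lie algebra are singular\<close>

lemma lie_bracket_entry: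
  assumes "X \<in> carrier_mat n n" "Y \<in> carrier_mat n n" "i < n" "j < n"
  shows "lie_bracket X Y $$ (i, j) =
    (\<Sum>k<n. X $$ (i, k) * Y $$ (k, j)) - (\<Sum>k<n. Y $$ (i, k) * X $$ (k, j))"
  using assms by (auto simp: lie_bracket_def scalar_prod_def lessThan_atLeast0)

lemma lie_bracket_carrier:
  assumes "X \<in> carrier_mat n n" "Y \<in> carrier_mat n n"
  shows "lie_bracket X Y \<in> carrier_mat n n"
  using assms by (auto simp: lie_bracket_def)

lemma lie_bracket_so:
  assumes X: "X \<in> so_algebra m" and Y: "Y \<in> so_algebra m"
  shows "lie_bracket X Y \<in> so_algebra m"
proof -
  note c = so_algebra_carrier[OF X] so_algebra_carrier[OF Y]
  have flip: "(\<Sum>k<2 * m. A $$ (i, k) * B $$ (k, j)) = (\<Sum>k<2 * m. B $$ (j, k) * A $$ (k, i))"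
    if A: "A \<in> so_algebra m" and B: "B \<in> so_algebra m" and ij: "i < 2 * m" "j < 2 * m" for A B i j
  proof (rule sum.cong[OF refl])
    fix k assume "k \<in> {..<2 * m}"
    then show "A $$ (i, k) * B $$ (k, j) = B $$ (j, k) * A $$ (k, i)"
      using so_algebra_skew[OF A ij(1), of k] so_algebra_skew[OF B _ ij(2), of k] by simp
  qed
  show ?thesis
  proof (rule so_algebraI[OF lie_bracket_carrier[OF c]])
    fix i j assume ij: "i < 2 * m" "j < 2 * m"
    show "lie_bracket X Y $$ (i, j) = - lie_bracket X Y $$ (j, i)"
      unfolding lie_bracket_entry[OF c ij] lie_bracket_entry[OF c ij(2,1)]
        flip[OF X Y ij] flip[OF Y X ij] by simp
  qed
qed

lemma lie_derived_so_subset: "A \<in> lie_derived (so_algebra m) \<Longrightarrow> A \<in> so_algebra m"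
proof (induction rule: lie_derived.induct)
  case (add A B)
  note c = so_algebra_carrier[OF add.IH(1)] so_algebra_carrier[OF add.IH(2)]
  show ?case
  proof (rule so_algebraI)
    fix i j assume ij: "i < 2 * m" "j < 2 * m"
    show "(A + B) $$ (i, j) = - (A + B) $$ (j, i)"
      using c ij so_algebra_skew[OF add.IH(1) ij] so_algebra_skew[OF add.IH(2) ij] by simp
  qed (use c in simp)
next
  case (smult A a)
  show ?case by (rule so_algebra_smult[OF smult.IH])
qed (rule lie_bracket_so)

text \<open>$\mathfrak{so}(2)$ is abelian.\<close>

lemma lie_derived_so_2:
  assumes "A \<in> lie_derived (so_algebra 1)"
  shows "A = 0\<^sub>m 2 2"
proof -
  have c: "X \<in> carrier_mat 2 2" if "X \<in> so_algebra 1" for X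
    using so_algebra_carrier[OF that] by simp
  have diag: "X $$ (i, i) = 0" if "X \<in> so_algebra 1" "i < 2" for X i
    using so_algebra_skew[OF that(1), of i i] that(2) by simp
  have A: "A \<in> so_algebra 1" using assms by (rule lie_derived_so_subset)
  have 01: "A $$ (0, 1) = 0" using assms
  proof (induction rule: lie_derived.induct)
    case (bracket X Y)
    then show ?case using diag[of X 0] diag[of X 1] diag[of Y 0] diag[of Y 1]
      by (simp add: lie_bracket_entry[OF c c] numeral_2_eq_2)
  next
    case (add A B)
    then show ?case using c[OF lie_derived_so_subset[OF add.hyps(1)]]
        c[OF lie_derived_so_subset[OF add.hyps(2)]] by simp
  next
    case (smult A a)
    then show ?case using c[OF lie_derived_so_subset[OF smult.hyps]] by simp
  qed
  have 10: "A $$ (1, 0) = 0" using so_algebra_skew[OF A, of 1 0] 01 by simp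
  show ?thesis
  proof (rule eq_matI)
    fix i j :: nat assume "i < dim_row (0\<^sub>m 2 2)" "j < dim_col (0\<^sub>m 2 2)"
    then have ij: "i < 2" "j < 2" by auto
    then have "i = j \<or> i = 0 \<and> j = 1 \<or> i = 1 \<and> j = 0" by auto
    then have "A $$ (i, j) = 0" using diag[OF A ij(1)] 01 10 by auto
    then show "A $$ (i, j) = 0\<^sub>m 2 2 $$ (i, j)" using ij by simp
  qed (use c[OF A] in auto)
qed

text \<open>The skew-symmetric matrix $v w^T - w v^T$ of the bivector $v \wedge w$, for vectors of equal
  dimension.\<close>

definition wedge :: "complex vec \<Rightarrow> complex vec \<Rightarrow> complex mat" where
  "wedge v w = Matrix.mat (dim_vec v) (dim_vec v)
     (\<lambda>(i, j). vec_index v i * vec_index w j - vec_index w i * vec_index v j)"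

text \<open>The operator $A + c$ on vectors, as a function that can be iterated.\<close>

definition shift_vec :: "complex mat \<Rightarrow> complex \<Rightarrow> complex vec \<Rightarrow> complex vec" where
  "shift_vec A c w = A *\<^sub>v w + c \<cdot>\<^sub>v w"

lemma wedge_so: "v \<in> carrier_vec (2 * m) \<Longrightarrow> wedge v w \<in> so_algebra m"
  by (rule so_algebraI) (auto simp: wedge_def)

lemma shift_vec_carrier [simp]:
  "A \<in> carrier_mat n n \<Longrightarrow> w \<in> carrier_vec n \<Longrightarrow> shift_vec A c w \<in> carrier_vec n"
  by (simp add: shift_vec_def)

lemma shift_vec_funpow_carrier [simp]:
  "A \<in> carrier_mat n n \<Longrightarrow> w \<in> carrier_vec n \<Longrightarrow> (shift_vec A c ^^ k) w \<in> carrier_vec n"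
  by (induction k) auto

text \<open>If \<open>v\<close> is an eigenvector with eigenvalue \<open>c\<close>, then $\mathrm{ad}(Y)$ acts on the bivectors
  divisible by \<open>v\<close> through the operator $Y + c$ on the other factor.\<close>

lemma lie_bracket_wedge:
  assumes Y: "Y \<in> so_algebra m" and v: "v \<in> carrier_vec (2 * m)" and w: "w \<in> carrier_vec (2 * m)"
    and ev: "Y *\<^sub>v v = c \<cdot>\<^sub>v v"
  shows "lie_bracket Y (wedge v w) = wedge v (shift_vec Y c w)"
proof -
  let ?n = "2 * m"
  have Yc: "Y \<in> carrier_mat ?n ?n" and Ws: "wedge v w \<in> carrier_mat ?n ?n"
    using Y wedge_so[OF v] by (auto dest: so_algebra_carrier)
  have mv: "vec_index (Y *\<^sub>v x) i = (\<Sum>k<?n. Y $$ (i, k) * vec_index x k)"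
    if "x \<in> carrier_vec ?n" "i < ?n" for x i
    using that Yc by (auto simp: scalar_prod_def lessThan_atLeast0)
  have skew: "(\<Sum>k<?n. vec_index x k * Y $$ (k, j)) = - vec_index (Y *\<^sub>v x) j"
    if "x \<in> carrier_vec ?n" "j < ?n" for x j
  proof -
    have "vec_index x k * Y $$ (k, j) = - (Y $$ (j, k) * vec_index x k)" if "k < ?n" for k
    proof -
      show ?thesis using so_algebra_skew[OF Y that \<open>j < ?n\<close>] by simp
    qed
    then show ?thesis using that by (simp add: mv sum_negf[symmetric])
  qed
  show ?thesis
  proof (rule eq_matI)
    fix i j assume "i < dim_row (wedge v (shift_vec Y c w))" "j < dim_col (wedge v (shift_vec Y c w))"
    then have ij: "i < ?n" "j < ?n" using v by (auto simp: wedge_def)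
    let ?v = "vec_index v" and ?w = "vec_index w"
    have "lie_bracket Y (wedge v w) $$ (i, j) =
        (\<Sum>k<?n. Y $$ (i, k) * (?v k * ?w j - ?w k * ?v j)) -
        (\<Sum>k<?n. (?v i * ?w k - ?w i * ?v k) * Y $$ (k, j))"
      unfolding lie_bracket_entry[OF Yc Ws ij] using v ij by (simp add: wedge_def)
    also have "(\<Sum>k<?n. Y $$ (i, k) * (?v k * ?w j - ?w k * ?v j)) =
        (\<Sum>k<?n. Y $$ (i, k) * ?v k) * ?w j - (\<Sum>k<?n. Y $$ (i, k) * ?w k) * ?v j"
      by (simp add: right_diff_distrib sum_subtractf sum_distrib_right mult.assoc)
    also have "(\<Sum>k<?n. (?v i * ?w k - ?w i * ?v k) * Y $$ (k, j)) =
        ?v i * (\<Sum>k<?n. ?w k * Y $$ (k, j)) - ?w i * (\<Sum>k<?n. ?v k * Y $$ (k, j))"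
      by (simp add: left_diff_distrib sum_subtractf sum_distrib_left mult.assoc)
    finally show "lie_bracket Y (wedge v w) $$ (i, j) = wedge v (shift_vec Y c w) $$ (i, j)"
      unfolding skew[OF v ij(2)] skew[OF w ij(2)] mv[OF v ij(1), symmetric] mv[OF w ij(1), symmetric] ev
      using v w ij Yc
      by (simp add: wedge_def shift_vec_def algebra_simps del: index_mult_mat_vec)
  qed (use v lie_bracket_carrier[OF Yc Ws] in \<open>auto simp: wedge_def\<close>)
qed

lemma lie_bracket_funpow_wedge:
  assumes "Y \<in> so_algebra m" "v \<in> carrier_vec (2 * m)" "w \<in> carrier_vec (2 * m)"
    "Y *\<^sub>v v = c \<cdot>\<^sub>v v"
  shows "(lie_bracket Y ^^ k) (wedge v w) = wedge v ((shift_vec Y c ^^ k) w)"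
proof (induction k)
  case (Suc k)
  have "Y \<in> carrier_mat (2 * m) (2 * m)" using assms(1) by (rule so_algebra_carrier)
  then show ?case using Suc assms by (simp add: lie_bracket_wedge)
qed simp

lemma wedge_eq_zero:
  assumes v: "v \<in> carrier_vec n" "v \<noteq> 0\<^sub>v n" and w: "w \<in> carrier_vec n"
    and 0: "wedge v w = 0\<^sub>m n n"
  shows "\<exists>c. w = c \<cdot>\<^sub>v v"
proof -
  obtain i where i: "i < n" "vec_index v i \<noteq> 0" using v by (auto simp: vec_eq_iff)
  have "w = (vec_index w i / vec_index v i) \<cdot>\<^sub>v v"
  proof (rule eq_vecI)
    fix j assume "j < dim_vec ((vec_index w i / vec_index v i) \<cdot>\<^sub>v v)"
    then have j: "j < n" using v by auto
    have "wedge v w $$ (i, j) = 0" using 0 i j by simp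
    then have "vec_index v i * vec_index w j = vec_index w i * vec_index v j"
      using v i j by (simp add: wedge_def)
    then show "vec_index w j = vec_index ((vec_index w i / vec_index v i) \<cdot>\<^sub>v v) j"
      using i j v by (simp add: field_simps)
  qed (use v w in auto)
  then show ?thesis by blast
qed

lemma shift_vec_adjoint:
  assumes Y: "Y \<in> so_algebra m" and x: "x \<in> carrier_vec (2 * m)" and y: "y \<in> carrier_vec (2 * m)"
  shows "scalar_prod (shift_vec Y c x) y = - scalar_prod x (shift_vec Y (- c) y)"
proof -
  have Yc: "Y \<in> carrier_mat (2 * m) (2 * m)" and t: "transpose_mat Y = - Y"
    using Y by (auto simp: so_algebra_def)
  have "scalar_prod (Y *\<^sub>v x) y = scalar_prod x (transpose_mat Y *\<^sub>v y)"
    using transpose_vec_mult_scalar[OF Yc x y] Yc x y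
    by (metis comm_scalar_prod mult_mat_vec_carrier transpose_carrier_mat)
  also have "\<dots> = - scalar_prod x (Y *\<^sub>v y)" using Yc x y unfolding t by simp
  finally show ?thesis
    unfolding shift_vec_def using Yc x y
    by (simp add: add_scalar_prod_distrib[of _ "2 * m"] scalar_prod_add_distrib[of _ "2 * m"])
qed

lemma shift_vec_funpow_adjoint:
  assumes Y: "Y \<in> so_algebra m" and x: "x \<in> carrier_vec (2 * m)" and y: "y \<in> carrier_vec (2 * m)"
  shows "scalar_prod ((shift_vec Y c ^^ k) x) y = (-1) ^ k * scalar_prod x ((shift_vec Y (- c) ^^ k) y)"
  using y
proof (induction k arbitrary: y)
  case (Suc k)
  have Yc: "Y \<in> carrier_mat (2 * m) (2 * m)" using Y by (rule so_algebra_carrier)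
  have "(shift_vec Y (- c) ^^ k) (shift_vec Y (- c) y) = (shift_vec Y (- c) ^^ Suc k) y"
    by (simp add: funpow_swap1)
  then show ?case using Suc x Yc by (simp add: shift_vec_adjoint[OF Y])
qed simp

lemma shift_vec_diff:
  assumes A: "A \<in> carrier_mat n n" and x: "x \<in> carrier_vec n" and v: "v \<in> carrier_vec n"
  shows "shift_vec A c (x - a \<cdot>\<^sub>v v) = shift_vec A c x - a \<cdot>\<^sub>v shift_vec A c v"
  unfolding shift_vec_def mult_minus_distrib_mat_vec[OF A x smult_carrier_vec[THEN iffD2, OF v]]
    mult_mat_vec[OF A v]
  using A x v by (intro eq_vecI) (simp_all add: algebra_simps del: index_mult_mat_vec)

lemma shift_vec_funpow_diff:
  assumes A: "A \<in> carrier_mat n n" and x: "x \<in> carrier_vec n" and v: "v \<in> carrier_vec n"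
  shows "(shift_vec A c ^^ k) (x - a \<cdot>\<^sub>v v) = (shift_vec A c ^^ k) x - a \<cdot>\<^sub>v (shift_vec A c ^^ k) v"
proof (induction k)
  case (Suc k)
  then show ?case using shift_vec_diff[OF A] A x v by simp
qed simp

lemma shift_vec_eigenvector:
  assumes "Y \<in> carrier_mat n n" "v \<in> carrier_vec n" "Y *\<^sub>v v = a \<cdot>\<^sub>v v"
  shows "(shift_vec Y c ^^ k) v = (a + c) ^ k \<cdot>\<^sub>v v"
proof (induction k)
  case (Suc k)
  then show ?case using assms
    by (simp add: shift_vec_def mult_mat_vec smult_smult_assoc[symmetric])
      (auto simp: algebra_simps intro!: eq_vecI)
qed (use assms in simp)

lemma exists_orthogonal_not_parallel:
  fixes v :: "complex vec"
  assumes v: "v \<in> carrier_vec n" "v \<noteq> 0\<^sub>v n" and n: "n \<ge> 3"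
  obtains x where "x \<in> carrier_vec n" "scalar_prod x v = 0" "\<And>c. x \<noteq> c \<cdot>\<^sub>v v"
proof -
  obtain i where i: "i < n" "vec_index v i \<noteq> 0" using v by (auto simp: vec_eq_iff)
  have "card ({..<n} - {i}) \<ge> 2" using n i by simp
  then obtain T where "T \<subseteq> {..<n} - {i}" "card T = 2" by (rule obtain_subset_with_card_n)
  then obtain a b where ab: "a \<in> {..<n} - {i}" "b \<in> {..<n} - {i}" "a \<noteq> b"
    by (auto simp: card_2_iff)
  \<comment> \<open>At most one of the vectors \<open>x a\<close> and \<open>x b\<close>, both orthogonal to \<open>v\<close>, is a multiple of \<open>v\<close>.\<close>
  define x where "x = (\<lambda>a. vec_index v a \<cdot>\<^sub>v unit_vec n i - vec_index v i \<cdot>\<^sub>v unit_vec n a)"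
  have x: "x a \<in> carrier_vec n" for a by (simp add: x_def)
  have orth: "scalar_prod (x a) v = 0" if "a < n" for a
    using that i v by (simp add: x_def minus_scalar_prod_distrib[of _ n])
  have parallel: "vec_index v a \<noteq> 0 \<and> vec_index v b = 0"
    if "a < n" "b < n" "a \<noteq> i" "b \<noteq> i" "a \<noteq> b" "x a = c \<cdot>\<^sub>v v" for a b c
  proof -
    have "vec_index (x a) a = c * vec_index v a" "vec_index (x a) b = c * vec_index v b"
      using that v by simp_all
    then show ?thesis using that i by (auto simp: x_def)
  qed
  show ?thesis
  proof (cases "\<exists>c. x a = c \<cdot>\<^sub>v v")
    case True
    then have "vec_index v b = 0" using parallel[of a b] ab by auto
    then have "x b \<noteq> c \<cdot>\<^sub>v v" for c using parallel[of b a c] ab by auto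
    then show ?thesis using that[of "x b"] x orth ab by auto
  next
    case False
    then show ?thesis using that[of "x a"] x orth ab by auto
  qed
qed

text \<open>The central component is zero, so the whole matrix lies in the derived algebra and is
  ad-nilpotent there.\<close>

lemma reductive_nilpotent_so:
  assumes "reductive_nilpotent (2 * m) (so_algebra m) N"
  shows "N \<in> lie_derived (so_algebra m)"
    and "\<exists>k. \<forall>X\<in>lie_derived (so_algebra m). (lie_bracket N ^^ k) X = 0\<^sub>m (2 * m) (2 * m)"
proof -
  obtain Z Y where "N = Z + Y" "Z = 0\<^sub>m (2 * m) (2 * m)" "Y \<in> lie_derived (so_algebra m)"
    and k: "\<exists>k. \<forall>X\<in>lie_derived (so_algebra m). (lie_bracket Y ^^ k) X = 0\<^sub>m (2 * m) (2 * m)"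
    using assms unfolding reductive_nilpotent_def by blast
  moreover have "Y \<in> carrier_mat (2 * m) (2 * m)"
    using calculation by (intro so_algebra_carrier lie_derived_so_subset)
  ultimately have "N = Y" by simp
  then show "N \<in> lie_derived (so_algebra m)"
    and "\<exists>k. \<forall>X\<in>lie_derived (so_algebra m). (lie_bracket N ^^ k) X = 0\<^sub>m (2 * m) (2 * m)"
    using \<open>Y \<in> lie_derived (so_algebra m)\<close> k by simp_all
qed

text \<open>For \<open>m = 1\<close> the derived algebra is zero. For $m \geq 2$, suppose that \<open>N\<close> is invertible, so $N v = c v$ with $c \neq 0$ and $v \neq 0$. Since
  $\mathrm{ad}(N)$ is nilpotent and maps $\mathfrak{so}(2m)$ into its derived algebra,
  $v \wedge (N + c)^{k+1} w = 0$ for all \<open>w\<close>: the image of $(N + c)^{k+1}$ is contained in the line of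
  \<open>v\<close>. By adjunction $(N - c)^{k+1}$ annihilates $v^\perp$. Since $2m \geq 3$, there is a nonzero vector in
  $v^\perp$ that $(N + c)^{k+1}$ annihilates, because \<open>v\<close> is isotropic and an eigenvector of $N + c$ with
  eigenvalue $2 c \neq 0$. Hence there is an eigenvector \<open>y\<close> in $v^\perp$ with eigenvalue \<open>- c\<close>, and
  $(N - c)^{k+1} y = (-2c)^{k+1} y \neq 0$, a contradiction.\<close>

lemma reductive_nilpotent_so_singular:
  assumes m: "m \<ge> 1" and nil: "reductive_nilpotent (2 * m) (so_algebra m) N"
  shows "Determinant.det N = 0"
proof (cases "m = 1")
  case True
  then have "N = 0\<^sub>m 2 2"
    using reductive_nilpotent_so(1)[OF nil] by (intro lie_derived_so_2) simp
  then show ?thesis by simp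
next
  case False
  let ?n = "2 * m"
  have n: "?n \<ge> 3" using m False by simp
  have N: "N \<in> so_algebra m" by (rule lie_derived_so_subset[OF reductive_nilpotent_so(1)[OF nil]])
  note Nc = so_algebra_carrier[OF N]
  obtain k where k: "\<And>X. X \<in> lie_derived (so_algebra m) \<Longrightarrow> (lie_bracket N ^^ k) X = 0\<^sub>m ?n ?n"
    using reductive_nilpotent_so(2)[OF nil] by blast
  show ?thesis
  proof (rule ccontr)
    assume det: "Determinant.det N \<noteq> 0"
    obtain c where "eigenvalue N c"
      using spectrum_non_empty[OF Nc] n unfolding spectrum_def by auto
    then obtain v where v: "v \<in> carrier_vec ?n" "v \<noteq> 0\<^sub>v ?n" and ev: "N *\<^sub>v v = c \<cdot>\<^sub>v v"
      using Nc unfolding eigenvalue_def eigenvector_def by auto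
    have c: "c \<noteq> 0"
    proof
      assume "c = 0"
      then have "N *\<^sub>v v = 0\<^sub>v ?n" using ev v by auto
      then show False using det_0_iff_vec_prod_zero[OF Nc] v det by blast
    qed
    have T: "(shift_vec N a ^^ j) w \<in> carrier_vec ?n" if "w \<in> carrier_vec ?n" for a j w
      by (rule shift_vec_funpow_carrier[OF Nc that])
    have image: "\<exists>b. (shift_vec N c ^^ Suc k) w = b \<cdot>\<^sub>v v" if w: "w \<in> carrier_vec ?n" for w
    proof (rule wedge_eq_zero[OF v T[OF w]])
      \<comment> \<open>One bracket moves the bivector into the derived algebra, hence \<open>Suc k\<close> instead of \<open>k\<close>.\<close>
      have "lie_bracket N (wedge v w) \<in> lie_derived (so_algebra m)"
        by (rule lie_derived.bracket[OF N wedge_so[OF v(1)]])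
      then have "(lie_bracket N ^^ Suc k) (wedge v w) = 0\<^sub>m ?n ?n"
        using k by (simp add: funpow_swap1)
      then show "wedge v ((shift_vec N c ^^ Suc k) w) = 0\<^sub>m ?n ?n"
        by (simp only: lie_bracket_funpow_wedge[OF N v(1) w ev])
    qed
    have kill: "(shift_vec N (- c) ^^ Suc k) y = 0\<^sub>v ?n"
      if y: "y \<in> carrier_vec ?n" "scalar_prod v y = 0" for y
    proof (rule eq_vecI)
      fix i assume "i < dim_vec (0\<^sub>v ?n)"
      then have i: "i < ?n" by simp
      obtain b where b: "(shift_vec N c ^^ Suc k) (unit_vec ?n i) = b \<cdot>\<^sub>v v"
        using image[of "unit_vec ?n i"] by auto
      have "(-1) ^ Suc k * scalar_prod (unit_vec ?n i) ((shift_vec N (- c) ^^ Suc k) y) =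
          scalar_prod (b \<cdot>\<^sub>v v) y"
        using shift_vec_funpow_adjoint[OF N _ y(1), of "unit_vec ?n i" "Suc k" c] b by simp
      then have "scalar_prod (unit_vec ?n i) ((shift_vec N (- c) ^^ Suc k) y) = 0"
        using v y by simp
      then show "vec_index ((shift_vec N (- c) ^^ Suc k) y) i = vec_index (0\<^sub>v ?n) i"
        using T[OF y(1), where a = "- c" and j = "Suc k"] i by (simp only: scalar_prod_left_unit index_zero_vec)
    qed (use T[OF y(1), where a = "- c" and j = "Suc k"] in auto)
    have vv: "scalar_prod v v = 0"
    proof -
      have "shift_vec N (- c) v = 0\<^sub>v ?n"
        using shift_vec_eigenvector[OF Nc v(1) ev, where c = "- c" and k = 1] v by auto
      then have "scalar_prod (shift_vec N c v) v = 0"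
        using shift_vec_adjoint[OF N v(1) v(1), of c] v by simp
      moreover have "shift_vec N c v = (2 * c) \<cdot>\<^sub>v v"
        using shift_vec_eigenvector[OF Nc v(1) ev, where c = c and k = 1] by simp
      ultimately show ?thesis using c v by simp
    qed
    obtain x\<^sub>0 where x\<^sub>0: "x\<^sub>0 \<in> carrier_vec ?n" "scalar_prod x\<^sub>0 v = 0" "\<And>b. x\<^sub>0 \<noteq> b \<cdot>\<^sub>v v"
      using exists_orthogonal_not_parallel[OF v n] by blast
    obtain b where b: "(shift_vec N c ^^ Suc k) x\<^sub>0 = b \<cdot>\<^sub>v v" using image[OF x\<^sub>0(1)] by blast
    \<comment> \<open>\<open>x\<close> is \<open>x\<^sub>0\<close> corrected by a multiple of \<open>v\<close> so that \<open>(N + c)^Suc k\<close> annihilates it.\<close>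
    define x where "x = x\<^sub>0 - (b / (c + c) ^ Suc k) \<cdot>\<^sub>v v"
    have x: "x \<in> carrier_vec ?n" using x\<^sub>0 v by (simp add: x_def)
    have "x \<noteq> 0\<^sub>v ?n"
    proof
      assume 0: "x = 0\<^sub>v ?n"
      have "x\<^sub>0 = (b / (c + c) ^ Suc k) \<cdot>\<^sub>v v"
      proof (rule eq_vecI)
        fix i assume "i < dim_vec ((b / (c + c) ^ Suc k) \<cdot>\<^sub>v v)"
        then have i: "i < ?n" using v by simp
        have "vec_index x i = 0" using 0 i by simp
        then show "vec_index x\<^sub>0 i = vec_index ((b / (c + c) ^ Suc k) \<cdot>\<^sub>v v) i"
          using i x\<^sub>0(1) v unfolding x_def by simp
      qed (use x\<^sub>0(1) v in simp)
      then show False using x\<^sub>0(3) by blast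
    qed
    have xv: "scalar_prod x v = 0"
      using x\<^sub>0 v vv by (simp add: x_def minus_scalar_prod_distrib[of _ ?n])
    have "(shift_vec N c ^^ Suc k) x = b \<cdot>\<^sub>v v - (b / (c + c) ^ Suc k) \<cdot>\<^sub>v ((c + c) ^ Suc k \<cdot>\<^sub>v v)"
      unfolding x_def shift_vec_funpow_diff[OF Nc x\<^sub>0(1) v(1)] b
        shift_vec_eigenvector[OF Nc v(1) ev] ..
    also have "\<dots> = 0\<^sub>v ?n" using c v(1) by (intro eq_vecI) auto
    finally have ex: "(shift_vec N c ^^ Suc k) x = 0\<^sub>v ?n" .
    \<comment> \<open>The last nonzero vector among the iterates of \<open>N + c\<close> on \<open>x\<close> is the eigenvector \<open>y\<close>.\<close>
    define p where "p = (LEAST p. (shift_vec N c ^^ p) x = 0\<^sub>v ?n)"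
    have p: "(shift_vec N c ^^ p) x = 0\<^sub>v ?n" unfolding p_def using ex by (rule LeastI)
    then obtain p' where p': "p = Suc p'" using \<open>x \<noteq> 0\<^sub>v ?n\<close> by (cases p) auto
    define y where "y = (shift_vec N c ^^ p') x"
    have y: "y \<in> carrier_vec ?n" unfolding y_def by (rule T[OF x])
    have "y \<noteq> 0\<^sub>v ?n" using not_less_Least[of p' "\<lambda>p. (shift_vec N c ^^ p) x = 0\<^sub>v ?n"] p'
      by (simp add: y_def p_def)
    have "scalar_prod y v = 0"
      unfolding y_def shift_vec_funpow_adjoint[OF N x v(1)] shift_vec_eigenvector[OF Nc v(1) ev]
      using xv x v by simp
    then have "scalar_prod v y = 0" using comm_scalar_prod[OF y v(1)] by simp
    then have "(shift_vec N (- c) ^^ Suc k) y = 0\<^sub>v ?n" using kill y by blast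
    moreover have "N *\<^sub>v y = (- c) \<cdot>\<^sub>v y"
    proof (rule eq_vecI)
      fix i assume "i < dim_vec ((- c) \<cdot>\<^sub>v y)"
      then have i: "i < ?n" using y by simp
      have "vec_index (shift_vec N c y) i = 0" using p i by (simp add: p' y_def)
      then show "vec_index (N *\<^sub>v y) i = vec_index ((- c) \<cdot>\<^sub>v y) i"
        using i y Nc by (simp add: shift_vec_def eq_neg_iff_add_eq_0 del: index_mult_mat_vec)
    qed (use Nc y in auto)
    ultimately have zero: "(- c + - c) ^ Suc k \<cdot>\<^sub>v y = 0\<^sub>v ?n"
      using shift_vec_eigenvector[OF Nc y, where a = "- c" and c = "- c" and k = "Suc k"] by simp
    have "y = 0\<^sub>v ?n"
    proof (rule eq_vecI)
      fix i assume "i < dim_vec (0\<^sub>v ?n)"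
      then have i: "i < ?n" by simp
      have "vec_index ((- c + - c) ^ Suc k \<cdot>\<^sub>v y) i = 0" using zero i by simp
      then show "vec_index y i = vec_index (0\<^sub>v ?n) i" using i y c by simp
    qed (use y in simp)
    then show False using \<open>y \<noteq> 0\<^sub>v ?n\<close> by contradiction
  qed
qed

section \<open>Local matrices of a Higgs field\<close>

lemma SO_groupD:
  assumes "g \<in> SO_group m"
  shows "g \<in> carrier_mat (2 * m) (2 * m)" "transpose_mat g * g = 1\<^sub>m (2 * m)"
    "g * transpose_mat g = 1\<^sub>m (2 * m)" "Determinant.det g = 1"
proof -
  show "g \<in> carrier_mat (2 * m) (2 * m)" "transpose_mat g * g = 1\<^sub>m (2 * m)" "Determinant.det g = 1"
    using assms by (auto simp: SO_group_def)
  then show "g * transpose_mat g = 1\<^sub>m (2 * m)"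
    using mat_mult_left_right_inverse[of "transpose_mat g" "2 * m" g] by simp
qed

lemma SO_group_one: "1\<^sub>m (2 * m) \<in> SO_group m"
  by (simp add: SO_group_def)

lemma SO_group_transpose:
  assumes "g \<in> SO_group m" shows "transpose_mat g \<in> SO_group m"
  using SO_groupD[OF assms] det_transpose[of g "2 * m"] by (simp add: SO_group_def)

lemma SO_group_mult:
  assumes g: "g \<in> SO_group m" and h: "h \<in> SO_group m" shows "g * h \<in> SO_group m"
proof -
  note G = SO_groupD[OF g] and H = SO_groupD[OF h]
  have "transpose_mat (g * h) * (g * h) = transpose_mat h * (transpose_mat g * g) * h"
    using G(1) H(1) by (simp add: transpose_mult[OF G(1) H(1)]
        assoc_mult_mat[of _ "2 * m" "2 * m" _ "2 * m" _ "2 * m"])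
  also have "\<dots> = 1\<^sub>m (2 * m)" unfolding G(2) using H by simp
  finally show ?thesis using G H by (simp add: SO_group_def det_mult[of g "2 * m"])
qed

lemma group_act_fibre:
  assumes "holomorphic_principal_SO_bundle C m P" and p: "p \<in> bundle_fibre P x"
  shows "group_act P p (1\<^sub>m (2 * m)) = p"
    and "g \<in> SO_group m \<Longrightarrow> group_act P p g \<in> bundle_fibre P x"
    and "g \<in> SO_group m \<Longrightarrow> h \<in> SO_group m \<Longrightarrow>
      group_act P (group_act P p g) h = group_act P p (g * h)"
proof -
  have "\<forall>p\<in>total_space P. group_act P p (1\<^sub>m (2 * m)) = p \<and>
      (\<forall>g\<in>SO_group m. group_act P p g \<in> total_space P \<and>
         bundle_proj P (group_act P p g) = bundle_proj P p \<and>
         (\<forall>h\<in>SO_group m. group_act P (group_act P p g) h = group_act P p (g * h)))"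
    using assms(1) unfolding holomorphic_principal_SO_bundle_def by (elim conjE)
  moreover have "p \<in> total_space P" "bundle_proj P p = x" using p by (auto simp: bundle_fibre_def)
  ultimately show "group_act P p (1\<^sub>m (2 * m)) = p"
    and "g \<in> SO_group m \<Longrightarrow> group_act P p g \<in> bundle_fibre P x"
    and "g \<in> SO_group m \<Longrightarrow> h \<in> SO_group m \<Longrightarrow>
      group_act P (group_act P p g) h = group_act P p (g * h)"
    by (auto simp: bundle_fibre_def)
qed

lemma local_frame_fibre:
  assumes "holomorphic_principal_SO_bundle C m P" "t \<in> trivializations P" "x \<in> fst t"
  shows "local_frame P m t x \<in> bundle_fibre P x" "snd t (local_frame P m t x) = 1\<^sub>m (2 * m)"
proof -
  have "bij_betw (snd t) (bundle_fibre P x) (SO_group m)"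
    using assms unfolding holomorphic_principal_SO_bundle_def by blast
  then have "1\<^sub>m (2 * m) \<in> snd t ` bundle_fibre P x"
    using SO_group_one by (simp add: bij_betw_def)
  then show "local_frame P m t x \<in> bundle_fibre P x" "snd t (local_frame P m t x) = 1\<^sub>m (2 * m)"
    unfolding local_frame_def by (rule inv_into_into, rule f_inv_into_f)
qed

lemma fibre_element_from_frame:
  assumes P: "holomorphic_principal_SO_bundle C m P" and t: "t \<in> trivializations P" "x \<in> fst t"
    and p: "p \<in> bundle_fibre P x"
  obtains g where "g \<in> SO_group m" "p = group_act P (local_frame P m t x) g"
proof
  have bij: "bij_betw (snd t) (bundle_fibre P x) (SO_group m)"
    and equiv: "\<And>q g. q \<in> bundle_fibre P x \<Longrightarrow> g \<in> SO_group m \<Longrightarrow> snd t (group_act P q g) = snd t q * g"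
    using P t unfolding holomorphic_principal_SO_bundle_def by blast+
  note f = local_frame_fibre[OF P t]
  show g: "snd t p \<in> SO_group m" using bij p by (auto simp: bij_betw_def)
  have "group_act P (local_frame P m t x) (snd t p) \<in> bundle_fibre P x"
    by (rule group_act_fibre(2)[OF P f(1) g])
  moreover have "snd t (group_act P (local_frame P m t x) (snd t p)) = snd t p"
    using equiv[OF f(1) g] f(2) SO_groupD(1)[OF g] by simp
  ultimately show "p = group_act P (local_frame P m t x) (snd t p)"
    using bij p by (auto simp: bij_betw_def inj_on_def)
qed

text \<open>The relation $[p g, g^{-1} X g] = [p, X]$ in the adjoint bundle.\<close>

lemma ad_class_group_act:
  assumes P: "holomorphic_principal_SO_bundle C m P" and p: "p \<in> bundle_fibre P x"
    and g: "g \<in> SO_group m" and X: "X \<in> carrier_mat (2 * m) (2 * m)"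
  shows "ad_class P m (group_act P p g) (transpose_mat g * X * g) = ad_class P m p X"
proof -
  note G = SO_groupD[OF g]
  have act: "group_act P (group_act P p g) h = group_act P p (g * h)" if "h \<in> SO_group m" for h
    by (rule group_act_fibre(3)[OF P p g that])
  have conj: "transpose_mat h * (transpose_mat g * X * g) * h = transpose_mat (g * h) * X * (g * h)"
    if "h \<in> SO_group m" for h
    unfolding transpose_mult[OF G(1) SO_groupD(1)[OF that]]
    using G(1) SO_groupD(1)[OF that] X
    by (simp add: assoc_mult_mat[of _ "2 * m" "2 * m" _ "2 * m" _ "2 * m"] del: assoc_mult_mat)
  have "(\<lambda>h. g * h) ` SO_group m = SO_group m"
  proof
    show "(\<lambda>h. g * h) ` SO_group m \<subseteq> SO_group m" using SO_group_mult[OF g] by blast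
    show "SO_group m \<subseteq> (\<lambda>h. g * h) ` SO_group m"
    proof
      fix k assume k: "k \<in> SO_group m"
      have "k = (g * transpose_mat g) * k" unfolding G(3) using SO_groupD(1)[OF k] by simp
      also have "\<dots> = g * (transpose_mat g * k)"
        using G(1) SO_groupD(1)[OF k] by (intro assoc_mult_mat) auto
      finally show "k \<in> (\<lambda>h. g * h) ` SO_group m"
        using SO_group_mult[OF SO_group_transpose[OF g] k] by blast
    qed
  qed
  then have "ad_class P m p X =
      (\<lambda>k. (group_act P p k, transpose_mat k * X * k)) ` (\<lambda>h. g * h) ` SO_group m"
    by (simp add: ad_class_def)
  also have "\<dots> = ad_class P m (group_act P p g) (transpose_mat g * X * g)"
    unfolding ad_class_def image_image using act conj by (intro image_cong refl) simp
  finally show ?thesis ..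
qed

text \<open>The group acts freely on the fibre, so the representative over a given point is unique.\<close>

lemma ad_class_inject:
  assumes P: "holomorphic_principal_SO_bundle C m P" and t: "t \<in> trivializations P" "x \<in> fst t"
    and p: "p \<in> bundle_fibre P x" and X: "X \<in> so_algebra m" and Y: "Y \<in> so_algebra m"
    and eq: "ad_class P m p X = ad_class P m p Y"
  shows "X = Y"
proof -
  have bij: "bij_betw (snd t) (bundle_fibre P x) (SO_group m)"
    and equiv: "\<And>g. g \<in> SO_group m \<Longrightarrow> snd t (group_act P p g) = snd t p * g"
    using P t p unfolding holomorphic_principal_SO_bundle_def by blast+
  have one: "group_act P p (1\<^sub>m (2 * m)) = p"
    by (rule group_act_fibre(1)[OF P p])
  have "(p, X) \<in> ad_class P m p X" unfolding ad_class_def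
    using one so_algebra_carrier[OF X] SO_group_one
    by (intro image_eqI[of _ _ "1\<^sub>m (2 * m)"]) auto
  then have "(p, X) \<in> ad_class P m p Y" by (simp only: eq)
  then obtain g where g: "g \<in> SO_group m" "p = group_act P p g" "X = transpose_mat g * Y * g"
    unfolding ad_class_def by blast
  note G = SO_groupD[OF g(1)]
  have s: "snd t p \<in> SO_group m" using bij p by (auto simp: bij_betw_def)
  note S = SO_groupD[OF s]
  have "snd t p * g = snd t p" using equiv[OF g(1)] g(2) by simp
  then have "transpose_mat (snd t p) * (snd t p * g) = 1\<^sub>m (2 * m)" using S by simp
  then have "g = 1\<^sub>m (2 * m)"
    using S G by (simp add: assoc_mult_mat[symmetric, of _ "2 * m" "2 * m" _ "2 * m" _ "2 * m"]
      del: assoc_mult_mat)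
  then show ?thesis using g(3) so_algebra_carrier[OF Y] by simp
qed

lemma local_matrix_eqI:
  assumes P: "holomorphic_principal_SO_bundle C m P" and t: "t \<in> trivializations P" "x \<in> fst t"
    and X: "X \<in> so_algebra m" and eq: "\<Phi> c x = ad_class P m (local_frame P m t x) X"
  shows "local_matrix P m \<Phi> c t x = X"
  unfolding local_matrix_def
proof (rule the_equality)
  show "X \<in> so_algebra m \<and> \<Phi> c x = ad_class P m (local_frame P m t x) X" using X eq by simp
next
  fix Y assume Y: "Y \<in> so_algebra m \<and> \<Phi> c x = ad_class P m (local_frame P m t x) Y"
  show "Y = X"
    by (rule ad_class_inject[OF P t local_frame_fibre(1)[OF P t]]) (use X Y eq in simp_all)
qed

lemma local_matrix_represents:
  assumes P: "holomorphic_principal_SO_bundle C m P" and t: "t \<in> trivializations P" "x \<in> fst t"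
    and \<Phi>: "\<Phi> c x \<in> ad_fibre P m x"
  shows "local_matrix P m \<Phi> c t x \<in> so_algebra m"
    and "\<Phi> c x = ad_class P m (local_frame P m t x) (local_matrix P m \<Phi> c t x)"
proof -
  obtain p X where p: "p \<in> bundle_fibre P x" and X: "X \<in> so_algebra m" and "\<Phi> c x = ad_class P m p X"
    using \<Phi> unfolding ad_fibre_def by blast
  obtain g where g: "g \<in> SO_group m" "p = group_act P (local_frame P m t x) g"
    by (rule fibre_element_from_frame[OF P t p])
  note G = SO_groupD[OF g(1)] and Xc = so_algebra_carrier[OF X]
  let ?X = "g * X * transpose_mat g"
  have X': "?X \<in> so_algebra m"
    using so_algebra_congruence[OF X, of "transpose_mat g"] G(1) by simp
  have "transpose_mat g * ?X * g = (transpose_mat g * g) * X * (transpose_mat g * g)"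
    using G(1) Xc by (simp add: assoc_mult_mat[of _ "2 * m" "2 * m" _ "2 * m" _ "2 * m"])
  also have "\<dots> = X" unfolding G(2) using Xc by simp
  finally have "transpose_mat g * ?X * g = X" .
  then have "\<Phi> c x = ad_class P m (local_frame P m t x) ?X"
    using ad_class_group_act[OF P local_frame_fibre(1)[OF P t] g(1) so_algebra_carrier[OF X']] g(2)
      \<open>\<Phi> c x = ad_class P m p X\<close> by simp
  moreover from this have "local_matrix P m \<Phi> c t x = ?X" by (rule local_matrix_eqI[OF P t X'])
  ultimately show "local_matrix P m \<Phi> c t x \<in> so_algebra m"
    and "\<Phi> c x = ad_class P m (local_frame P m t x) (local_matrix P m \<Phi> c t x)"
    using X' by simp_all
qed

text \<open>Changing the trivialization conjugates the local matrix by an element of determinant \<open>1\<close>.\<close>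

lemma pfaffian_local_matrix_independent:
  assumes P: "holomorphic_principal_SO_bundle C m P"
    and t: "t \<in> trivializations P" "x \<in> fst t" and u: "u \<in> trivializations P" "x \<in> fst u"
    and \<Phi>: "\<Phi> c x \<in> ad_fibre P m x"
  shows "pfaffian m (local_matrix P m \<Phi> c u x) = pfaffian m (local_matrix P m \<Phi> c t x)"
proof -
  let ?X = "local_matrix P m \<Phi> c t x"
  note X = local_matrix_represents[where \<Phi> = \<Phi> and c = c, OF P t \<Phi>]
  note ft = local_frame_fibre(1)[OF P t] and fu = local_frame_fibre(1)[OF P u]
  obtain g where g: "g \<in> SO_group m" "local_frame P m u x = group_act P (local_frame P m t x) g"
    by (rule fibre_element_from_frame[OF P t fu])
  note G = SO_groupD[OF g(1)]
  have "\<Phi> c x = ad_class P m (local_frame P m u x) (transpose_mat g * ?X * g)"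
    using ad_class_group_act[OF P ft g(1) so_algebra_carrier[OF X(1)]] X(2) g(2) by simp
  then have "local_matrix P m \<Phi> c u x = transpose_mat g * ?X * g"
    by (rule local_matrix_eqI[OF P u so_algebra_congruence[OF X(1) G(1)]])
  then show ?thesis using pfaffian_congruence[OF so_algebra_carrier[OF X(1)] G(1)] G(4) by simp
qed

lemma higgs_pfaffian_eq:
  assumes "holomorphic_principal_SO_bundle C m P" "t \<in> trivializations P" "x \<in> fst t"
    "\<Phi> c x \<in> ad_fibre P m x"
  shows "higgs_pfaffian m P \<Phi> c x = pfaffian m (local_matrix P m \<Phi> c t x)"
  unfolding higgs_pfaffian_def
  by (rule the_equality) (use assms pfaffian_local_matrix_independent[OF assms(1)] in blast)+

lemma ad_scale_ad_class:
  assumes "X \<in> carrier_mat (2 * m) (2 * m)"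
  shows "ad_scale a (ad_class P m p X) = ad_class P m p (a \<cdot>\<^sub>m X)"
  unfolding ad_scale_def ad_class_def image_image
proof (rule image_cong[OF refl])
  fix g assume "g \<in> SO_group m"
  note G = SO_groupD(1)[OF this]
  have "transpose_mat g * (a \<cdot>\<^sub>m X) * g = a \<cdot>\<^sub>m (transpose_mat g * X * g)"
    using G assms by (simp add: mult_smult_distrib[of _ "2 * m" "2 * m"] mult_smult_assoc_mat[of _ "2 * m" "2 * m"])
  then show "(case (group_act P p g, transpose_mat g * X * g) of (p, X) \<Rightarrow> (p, a \<cdot>\<^sub>m X)) =
      (group_act P p g, transpose_mat g * (a \<cdot>\<^sub>m X) * g)" by simp
qed

section \<open>Pole order of the Pfaffian at a simple pole\<close>

lemma pole_order_le_cong: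
  assumes f: "pole_order_le n f a" and "r > 0" and "\<And>w. w \<in> ball a r - {a} \<Longrightarrow> g w = f w"
  shows "pole_order_le n g a"
proof -
  obtain r' h where "r' > 0" "h holomorphic_on ball a r'"
    "\<And>w. w \<in> ball a r' - {a} \<Longrightarrow> f w = (w - a) powi (- n) * h w"
    using f unfolding pole_order_le_def by blast
  then show ?thesis
    unfolding pole_order_le_def using assms(2,3)
    by (intro exI[of _ "min r r'"] exI[of _ h] conjI)
      (auto elim!: holomorphic_on_subset)
qed

lemma pole_order_le_residue:
  assumes "r > 0" "h holomorphic_on ball a r"
    and f: "\<And>w. w \<in> ball a r - {a} \<Longrightarrow> f w = (w - a) powi (-1) * h w"
  shows "residue f a = h a"
proof -
  have "residue f a = residue (\<lambda>w. h w / (w - a)) a"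
  proof (rule residue_cong[OF _ refl])
    show "\<forall>\<^sub>F w in at a. f w = h w / (w - a)"
      using f assms(1) eventually_at_in_open'[of "ball a r" a]
      by (auto elim!: eventually_mono simp: eventually_at_filter field_simps power_int_minus)
  qed
  then show ?thesis using residue_simple[of "ball a r" a h] assms by simp
qed

text \<open>The local statement: a corank of at least \<open>2 * k - 1\<close> of the residue saves \<open>k\<close> orders in the
  pole of the Pfaffian. With $M = H / (w - a)$ and $H(a) = N$, a congruence that clears rows and columns
  of \<open>N\<close> shows that the Pfaffian of \<open>H\<close> vanishes to order \<open>k\<close> at \<open>a\<close>.\<close>

lemma pole_order_le_pfaffian:
  fixes M :: "complex \<Rightarrow> complex mat"
  assumes "r > 0"
    and dim: "\<And>w. w \<in> ball a r - {a} \<Longrightarrow> M w \<in> carrier_mat (2 * m) (2 * m)"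
    and pole: "\<And>i j. i < 2 * m \<Longrightarrow> j < 2 * m \<Longrightarrow> pole_order_le 1 (\<lambda>w. M w $$ (i, j)) a"
    and N_def: "N = Matrix.mat (2 * m) (2 * m) (\<lambda>(i, j). residue (\<lambda>w. M w $$ (i, j)) a)"
    and N: "N \<in> so_algebra m"
    and k: "2 * k \<le> 2 * m - vec_space.rank (2 * m) N + 1"
  shows "pole_order_le (int m - int k) (\<lambda>w. pfaffian m (M w)) a"
proof -
  obtain \<rho> h where \<rho>: "\<And>i j. i < 2 * m \<Longrightarrow> j < 2 * m \<Longrightarrow> \<rho> i j > 0"
    and h: "\<And>i j. i < 2 * m \<Longrightarrow> j < 2 * m \<Longrightarrow> h i j holomorphic_on ball a (\<rho> i j)"
    and Mh: "\<And>i j w. i < 2 * m \<Longrightarrow> j < 2 * m \<Longrightarrow> w \<in> ball a (\<rho> i j) - {a} \<Longrightarrow>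
      M w $$ (i, j) = (w - a) powi (-1) * h i j w"
    using pole unfolding pole_order_le_def by metis
  define R where "R = Min (insert r ((\<lambda>(i, j). \<rho> i j) ` ({..<2 * m} \<times> {..<2 * m})))"
  have R: "R > 0" "R \<le> r" and R\<rho>: "\<And>i j. i < 2 * m \<Longrightarrow> j < 2 * m \<Longrightarrow> R \<le> \<rho> i j"
    unfolding R_def using \<open>r > 0\<close> \<rho> by (auto intro!: Min_le)
  have hR: "h i j holomorphic_on ball a R" if "i < 2 * m" "j < 2 * m" for i j
    by (rule holomorphic_on_subset[OF h[OF that]]) (use R\<rho>[OF that] in auto)
  define H where "H = (\<lambda>w. Matrix.mat (2 * m) (2 * m) (\<lambda>(i, j). h i j w))"
  have H: "H w \<in> carrier_mat (2 * m) (2 * m)" for w by (simp add: H_def)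
  have MH: "M w = inverse (w - a) \<cdot>\<^sub>m H w" if w: "w \<in> ball a R - {a}" for w
  proof (rule eq_matI)
    have Mw: "M w \<in> carrier_mat (2 * m) (2 * m)" using w R by (intro dim) auto
    then show "dim_row (M w) = dim_row (inverse (w - a) \<cdot>\<^sub>m H w)"
      "dim_col (M w) = dim_col (inverse (w - a) \<cdot>\<^sub>m H w)" by (auto simp: H_def)
    fix i j assume "i < dim_row (inverse (w - a) \<cdot>\<^sub>m H w)" "j < dim_col (inverse (w - a) \<cdot>\<^sub>m H w)"
    then have ij: "i < 2 * m" "j < 2 * m" by (auto simp: H_def)
    have "w \<in> ball a (\<rho> i j) - {a}" using w R\<rho>[OF ij] by auto
    then show "M w $$ (i, j) = (inverse (w - a) \<cdot>\<^sub>m H w) $$ (i, j)"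
      using Mh[OF ij] ij by (simp add: H_def power_int_minus)
  qed
  have NH: "N = H a"
  proof (rule eq_matI)
    fix i j assume "i < dim_row (H a)" "j < dim_col (H a)"
    then have ij: "i < 2 * m" "j < 2 * m" by (auto simp: H_def)
    show "N $$ (i, j) = H a $$ (i, j)"
      using pole_order_le_residue[OF \<rho>[OF ij] h[OF ij] Mh[OF ij]] ij by (simp add: N_def H_def)
  qed (simp_all add: N_def H_def)
  obtain B Z where B: "B \<in> carrier_mat (2 * m) (2 * m)" and det: "Determinant.det B \<noteq> 0"
    and Z: "Z \<subseteq> {..<2 * m}" and cardZ: "card Z = 2 * m - vec_space.rank (2 * m) N"
    and van: "\<And>i j. i < 2 * m \<Longrightarrow> j < 2 * m \<Longrightarrow> i \<in> Z \<or> j \<in> Z \<Longrightarrow>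
      (transpose_mat B * N * B) $$ (i, j) = 0"
    using so_algebra_congruence_vanishing[OF N] by blast
  obtain f where f: "f holomorphic_on ball a R"
    and pf: "\<And>w. pfaffian m (transpose_mat B * H w * B) = (w - a) ^ k * f w"
  proof (rule pfaffian_vanishing_order[of "ball a R" "\<lambda>w. transpose_mat B * H w * B" m Z a k])
    show "transpose_mat B * H w * B \<in> carrier_mat (2 * m) (2 * m)" for w
      by (intro mult_carrier_mat[of _ "2 * m" "2 * m"] transpose_carrier_mat[THEN iffD2] B H)
    fix i j assume ij: "i < 2 * m" "j < 2 * m"
    have "(\<lambda>w. \<Sum>q\<in>{..<2 * m} \<times> {..<2 * m}. h (fst q) (snd q) w * (B $$ (fst q, i) * B $$ (snd q, j)))
        holomorphic_on ball a R"
      by (intro holomorphic_on_sum holomorphic_on_mult holomorphic_on_const hR) auto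
    moreover have "(transpose_mat B * H w * B) $$ (i, j) =
        (\<Sum>q\<in>{..<2 * m} \<times> {..<2 * m}. h (fst q) (snd q) w * (B $$ (fst q, i) * B $$ (snd q, j)))" for w
      unfolding congruence_entry[OF H B ij] by (intro sum.cong refl) (auto simp: H_def)
    ultimately show "(\<lambda>w. (transpose_mat B * H w * B) $$ (i, j)) holomorphic_on ball a R" by simp
  qed (use van cardZ Z k NH that in auto)
  have "pfaffian m (M w) = (w - a) powi (- (int m - int k)) * (f w / Determinant.det B)"
    if w: "w \<in> ball a R - {a}" for w
  proof -
    have "pfaffian m (H w) = (w - a) ^ k * f w / Determinant.det B"
      using pf[of w] det unfolding pfaffian_congruence[OF H B] by (simp add: field_simps)
    then have "pfaffian m (M w) = inverse (w - a) ^ m * (w - a) ^ k * (f w / Determinant.det B)"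
      unfolding MH[OF w] pfaffian_smult[OF H] by simp
    also have "inverse (w - a) ^ m * (w - a) ^ k = (w - a) powi (- (int m - int k))"
      using w power_int_add[of "w - a" "- int m" "int k"]
      by (simp add: power_int_minus power_inverse)
    finally show ?thesis .
  qed
  moreover have "(\<lambda>w. f w / Determinant.det B) holomorphic_on ball a R"
    using f det by (intro holomorphic_on_divide holomorphic_on_const) auto
  ultimately show ?thesis unfolding pole_order_le_def using R(1) by blast
qed

section \<open>Coordinate charts\<close>

lemma holomorphic_on_pfaffian:
  assumes "\<And>i j. i < 2 * m \<Longrightarrow> j < 2 * m \<Longrightarrow> (\<lambda>w. M w $$ (i, j)) holomorphic_on S"
  shows "(\<lambda>w. pfaffian m (M w)) holomorphic_on S"
proof -
  have "(\<lambda>w. \<Prod>i<m. M w $$ (\<sigma> (2 * i), \<sigma> (2 * i + 1))) holomorphic_on S"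
    if \<sigma>: "\<sigma> permutes {..<2 * m}" for \<sigma>
  proof -
    have "\<sigma> j < 2 * m" if "j < 2 * m" for j using permutes_in_image[OF \<sigma>, of j] that by simp
    then show ?thesis by (intro holomorphic_on_prod assms) auto
  qed
  then show ?thesis
    unfolding pfaffian_def
    by (intro holomorphic_on_mult holomorphic_on_const holomorphic_on_sum) simp
qed

lemma complex_chart_open_image:
  assumes c: "complex_chart X c" and W: "openin X W" "W \<subseteq> fst c"
  shows "open (snd c ` W)"
proof -
  have "openin (subtopology X (fst c)) W" using W by (metis openin_subset_topspace_eq openin_subtopology_Int2 inf.absorb2)
  moreover have "W \<subseteq> topspace (subtopology X (fst c))" using W openin_subset by fastforce
  ultimately have "openin (top_of_set (snd c ` fst c)) (snd c ` W)"
    using c homeomorphic_map_openness unfolding complex_chart_def by blast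
  then show ?thesis using c openin_open_trans unfolding complex_chart_def by blast
qed

lemma chart_inv_apply:
  assumes c: "complex_chart X c" and x: "x \<in> fst c"
  shows "chart_inv c (snd c x) = x"
proof -
  have "inj_on (snd c) (topspace (subtopology X (fst c)))"
    using c homeomorphic_imp_injective_map unfolding complex_chart_def by blast
  moreover have "topspace (subtopology X (fst c)) = fst c"
    using c openin_subset unfolding complex_chart_def by (fastforce simp: topspace_subtopology)
  ultimately show ?thesis using x unfolding chart_inv_def by simp
qed

section \<open>The Pfaffian as a differential on the surface\<close>

text \<open>The local bound, applied at every point of \<open>D\<close>, and the transformation of local matrices
  under a change of coordinates.\<close>

lemma higgs_pfaffian_in_H0:
  fixes C :: "'a surface" and P :: "('a, 'p) principal_bundle"
  assumes C: "compact_riemann_surface C" and D: "finite D"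
    and \<Phi>: "log_SO_higgs_bundle C D m P \<Phi>"
    and so: "\<And>p N. p \<in> D \<Longrightarrow> N \<in> residue_matrices C m P \<Phi> p \<Longrightarrow> N \<in> so_algebra m"
    and rank: "\<And>p N. p \<in> D \<Longrightarrow> N \<in> residue_matrices C m P \<Phi> p \<Longrightarrow>
      2 * k \<le> 2 * m - vec_space.rank (2 * m) N + 1"
  shows "higgs_pfaffian m P \<Phi> \<in> H0_canonical_power C D m (int m - int k)"
proof -
  let ?X = "surface_top C"
  let ?M = "local_matrix P m \<Phi>" and ?\<omega> = "higgs_pfaffian m P \<Phi>"
  have P: "holomorphic_principal_SO_bundle C m P"
    and ad: "\<And>c x. c \<in> surface_atlas C \<Longrightarrow> x \<in> fst c - D \<Longrightarrow> \<Phi> c x \<in> ad_fibre P m x"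
    and change: "\<And>c d x. c \<in> surface_atlas C \<Longrightarrow> d \<in> surface_atlas C \<Longrightarrow> x \<in> fst c \<inter> fst d - D \<Longrightarrow>
      \<Phi> c x = ad_scale (coord_deriv d c x) (\<Phi> d x)"
    and hol: "\<And>c t i j. c \<in> surface_atlas C \<Longrightarrow> t \<in> trivializations P \<Longrightarrow> i < 2 * m \<Longrightarrow> j < 2 * m \<Longrightarrow>
      (\<lambda>w. ?M c t (chart_inv c w) $$ (i, j)) holomorphic_on (snd c ` (fst c \<inter> fst t - D))"
    and pole: "\<And>c t i j p. c \<in> surface_atlas C \<Longrightarrow> t \<in> trivializations P \<Longrightarrow> i < 2 * m \<Longrightarrow> j < 2 * m \<Longrightarrow>
      p \<in> fst c \<inter> fst t \<inter> D \<Longrightarrow> pole_order_le 1 (\<lambda>w. ?M c t (chart_inv c w) $$ (i, j)) (snd c p)"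
    using \<Phi> unfolding log_SO_higgs_bundle_def by blast+
  have triv_open: "openin ?X (fst t)" if "t \<in> trivializations P" for t
    using P that unfolding holomorphic_principal_SO_bundle_def by blast
  have triv_cover: "\<exists>t\<in>trivializations P. x \<in> fst t" if "x \<in> topspace ?X" for x
    using P that unfolding holomorphic_principal_SO_bundle_def by blast
  have chart: "complex_chart ?X c" if "c \<in> surface_atlas C" for c
    using C that unfolding compact_riemann_surface_def by blast
  have chart_open: "openin ?X (fst c)" if "c \<in> surface_atlas C" for c
    using chart[OF that] unfolding complex_chart_def by blast
  have chart_sub: "x \<in> topspace ?X" if "c \<in> surface_atlas C" "x \<in> fst c" for c x
    using openin_subset[OF chart_open[OF that(1)]] that(2) by blast
  have open_image: "open (snd c ` (fst c \<inter> fst t - E))"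
    if c: "c \<in> surface_atlas C" and t: "t \<in> trivializations P" and E: "E \<subseteq> D" for c t E
  proof (rule complex_chart_open_image[OF chart[OF c]])
    have "closedin ?X (E \<inter> topspace ?X)"
      using C D E finite_subset unfolding compact_riemann_surface_def
      by (intro closedin_Hausdorff_finite) auto
    then have "openin ?X (fst c \<inter> fst t - E \<inter> topspace ?X)"
      by (intro openin_diff openin_Int chart_open[OF c] triv_open[OF t])
    moreover have "fst c \<inter> fst t - E \<inter> topspace ?X = fst c \<inter> fst t - E"
      using chart_sub[OF c] by blast
    ultimately show "openin ?X (fst c \<inter> fst t - E)" by simp
  qed blast
  have inv: "chart_inv c (snd c x) = x" if "c \<in> surface_atlas C" "x \<in> fst c" for c x
    by (rule chart_inv_apply[OF chart[OF that(1)] that(2)])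
  have so_M: "?M c t x \<in> so_algebra m"
    if "c \<in> surface_atlas C" "t \<in> trivializations P" "x \<in> fst c \<inter> fst t - D" for c t x
    by (rule local_matrix_represents(1)[where \<Phi> = \<Phi> and c = c, OF P that(2)])
      (use ad that in blast)+
  have \<omega>: "?\<omega> c x = pfaffian m (?M c t x)"
    if "c \<in> surface_atlas C" "t \<in> trivializations P" "x \<in> fst c \<inter> fst t - D" for c t x
    by (rule higgs_pfaffian_eq[where \<Phi> = \<Phi> and c = c, OF P that(2)]) (use ad that in blast)+
  show ?thesis unfolding H0_canonical_power_def
  proof (intro CollectI conjI ballI)
    fix c d x assume c: "c \<in> surface_atlas C" and d: "d \<in> surface_atlas C" and x: "x \<in> fst c \<inter> fst d - D"
    obtain t where t: "t \<in> trivializations P" "x \<in> fst t" using triv_cover chart_sub[OF c] x by blast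
    have x': "x \<in> fst c \<inter> fst t - D" "x \<in> fst d \<inter> fst t - D" using x t by auto
    let ?a = "coord_deriv d c x"
    note Md = so_M[OF d t(1) x'(2)]
    have "\<Phi> d x = ad_class P m (local_frame P m t x) (?M d t x)"
      by (rule local_matrix_represents(2)[where \<Phi> = \<Phi> and c = d, OF P t]) (use ad d x in blast)
    then have "\<Phi> c x = ad_class P m (local_frame P m t x) (?a \<cdot>\<^sub>m ?M d t x)"
      using change[OF c d x] ad_scale_ad_class[OF so_algebra_carrier[OF Md]] by simp
    then have "?M c t x = ?a \<cdot>\<^sub>m ?M d t x"
      by (rule local_matrix_eqI[OF P t so_algebra_smult[OF Md]])
    then show "?\<omega> c x = ?a ^ m * ?\<omega> d x"
      unfolding \<omega>[OF c t(1) x'(1)] \<omega>[OF d t(1) x'(2)]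
      by (simp only: pfaffian_smult[OF so_algebra_carrier[OF Md]])
  next
    fix c assume c: "c \<in> surface_atlas C"
    have "snd c ` (fst c - D) = (\<Union>t\<in>trivializations P. snd c ` (fst c \<inter> fst t - D))"
      using triv_cover chart_sub[OF c] by blast
    moreover have "(?\<omega> c \<circ> chart_inv c) holomorphic_on
        (\<Union>t\<in>trivializations P. snd c ` (fst c \<inter> fst t - D))"
    proof (rule holomorphic_on_UN_open)
      fix t assume t: "t \<in> trivializations P"
      show "open (snd c ` (fst c \<inter> fst t - D))" by (rule open_image[OF c t]) simp
      have "(\<lambda>w. pfaffian m (?M c t (chart_inv c w))) holomorphic_on snd c ` (fst c \<inter> fst t - D)"
        by (intro holomorphic_on_pfaffian hol[OF c t])
      then show "(?\<omega> c \<circ> chart_inv c) holomorphic_on snd c ` (fst c \<inter> fst t - D)"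
        by (rule holomorphic_transform) (use \<omega>[OF c t] inv[OF c] in auto)
    qed
    ultimately show "(?\<omega> c \<circ> chart_inv c) holomorphic_on snd c ` (fst c - D)" by simp
  next
    fix c p assume c: "c \<in> surface_atlas C" and p: "p \<in> fst c \<inter> D"
    obtain t where t: "t \<in> trivializations P" "p \<in> fst t" using triv_cover chart_sub[OF c] p by blast
    let ?a = "snd c p"
    have "open (snd c ` (fst c \<inter> fst t - (D - {p})))" by (rule open_image[OF c t(1)]) blast
    moreover have "?a \<in> snd c ` (fst c \<inter> fst t - (D - {p}))" using p t by blast
    ultimately obtain r where r: "r > 0" "ball ?a r \<subseteq> snd c ` (fst c \<inter> fst t - (D - {p}))"
      using open_contains_ball by blast
    have near: "chart_inv c w \<in> fst c \<inter> fst t - D" if w: "w \<in> ball ?a r - {?a}" for w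
    proof -
      obtain x where x: "x \<in> fst c \<inter> fst t - (D - {p})" "w = snd c x" using r(2) w by blast
      then show ?thesis using w inv[OF c, of x] by auto
    qed
    let ?M' = "\<lambda>w. ?M c t (chart_inv c w)"
    define N where "N = Matrix.mat (2 * m) (2 * m) (\<lambda>(i, j). residue (\<lambda>w. ?M' w $$ (i, j)) ?a)"
    have N: "N \<in> residue_matrices C m P \<Phi> p"
      unfolding residue_matrices_def N_def using c t p by blast
    have "pole_order_le (int m - int k) (\<lambda>w. pfaffian m (?M' w)) ?a"
    proof (rule pole_order_le_pfaffian[OF r(1) _ _ N_def])
      show "?M' w \<in> carrier_mat (2 * m) (2 * m)" if "w \<in> ball ?a r - {?a}" for w
        by (rule so_algebra_carrier[OF so_M[OF c t(1) near[OF that]]])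
      show "pole_order_le 1 (\<lambda>w. ?M' w $$ (i, j)) ?a" if "i < 2 * m" "j < 2 * m" for i j
        by (rule pole[OF c t(1) that]) (use p t in blast)
      show "N \<in> so_algebra m" "2 * k \<le> 2 * m - vec_space.rank (2 * m) N + 1"
        using so[OF _ N] rank[OF _ N] p by simp_all
    qed
    then show "pole_order_le (int m - int k) (?\<omega> c \<circ> chart_inv c) ?a"
      by (rule pole_order_le_cong[OF _ r(1)]) (use \<omega>[OF c t(1) near] in simp)
  qed
qed

theorem corollary5p8:
  fixes C :: "'a surface" and D :: "'a set" and g m :: nat
    and P :: "('a, 'p) principal_bundle" and \<Phi> :: "('a, 'p) higgs"
  assumes "compact_riemann_surface C" and "has_genus C g" and "g \<ge> 2"
    and "finite D" and "D \<subseteq> topspace (surface_top C)"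
    and "m \<ge> 1"
    and "log_SO_higgs_bundle C D m P \<Phi>"
    and "nilpotent_residues C D m P \<Phi>"
  shows "higgs_pfaffian m P \<Phi> \<in> H0_canonical_power C D m (int m - 1) \<and>
    ((\<forall>p\<in>D. \<forall>N\<in>residue_matrices C m P \<Phi> p. int (vec_space.rank (2 * m) N) \<le> 2 * int m - 4) \<longrightarrow>
      higgs_pfaffian m P \<Phi> \<in> H0_canonical_power C D m (int m - 2))"
proof -
  have residue: "N \<in> so_algebra m" "vec_space.rank (2 * m) N < 2 * m"
    if "p \<in> D" "N \<in> residue_matrices C m P \<Phi> p" for p N
  proof -
    have nil: "reductive_nilpotent (2 * m) (so_algebra m) N"
      using assms(8) that unfolding nilpotent_residues_def by blast
    show N: "N \<in> so_algebra m" by (rule lie_derived_so_subset[OF reductive_nilpotent_so(1)[OF nil]])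
    have "vec_space.rank (2 * m) N \<noteq> 2 * m"
      using vec_space.det_rank_iff[OF so_algebra_carrier[OF N]]
        reductive_nilpotent_so_singular[OF assms(6) nil] by blast
    then show "vec_space.rank (2 * m) N < 2 * m"
      using vec_space.rank_le_nc[OF so_algebra_carrier[OF N]] by simp
  qed
  show ?thesis
  proof (intro conjI impI)
    have "higgs_pfaffian m P \<Phi> \<in> H0_canonical_power C D m (int m - int 1)"
    proof (rule higgs_pfaffian_in_H0[OF assms(1,4,7)])
      fix p N assume pN: "p \<in> D" "N \<in> residue_matrices C m P \<Phi> p"
      show "N \<in> so_algebra m" "2 * 1 \<le> 2 * m - vec_space.rank (2 * m) N + 1"
        using residue[OF pN] by simp_all
    qed
    then show "higgs_pfaffian m P \<Phi> \<in> H0_canonical_power C D m (int m - 1)" by simp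
  next
    assume rank: "\<forall>p\<in>D. \<forall>N\<in>residue_matrices C m P \<Phi> p.
      int (vec_space.rank (2 * m) N) \<le> 2 * int m - 4"
    have "higgs_pfaffian m P \<Phi> \<in> H0_canonical_power C D m (int m - int 2)"
    proof (rule higgs_pfaffian_in_H0[OF assms(1,4,7)])
      fix p N assume pN: "p \<in> D" "N \<in> residue_matrices C m P \<Phi> p"
      have "int (vec_space.rank (2 * m) N) \<le> 2 * int m - 4" using rank pN by blast
      then show "N \<in> so_algebra m" "2 * 2 \<le> 2 * m - vec_space.rank (2 * m) N + 1"
        using residue[OF pN] by simp_all
    qed
    then show "higgs_pfaffian m P \<Phi> \<in> H0_canonical_power C D m (int m - 2)" by simp
  qed
qed

end
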